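(* Fix $\eta\in(0,1]$ and $\varepsilon>0$. There is an algorithm for the insertion-only continual release model that receives a public integer $\tilde\alpha\ge1$ and, after every update $t\in[T]$, releases an estimate of $M(G_t)$, the size of a maximum matching of $G_t$, with the following guarantees: (o) for every value of $\tilde\alpha$, the algorithm is $\varepsilon$-node differentially private; (i) if $\tilde\alpha\ge\alpha:=\max_{t\in[T]}\mathrm{arb}(G_t)$, then with probability at least $1-1/\mathrm{poly}(n)$, at every timestamp the released estimate is a $\left((1+\eta)(2+\tilde\alpha),\,O(\varepsilon^{-1}\eta^{-2}\tilde\alpha\log^2 n)\right)$-approximation of $M(G_t)$; (ii) the space complexity is $O\!\left(n\log(\eta^{-1}\tilde\alpha)+\varepsilon^{-1}\eta^{-3}\tilde\alpha\log^2(n)\log(\tilde\alpha)\right)$; (iii) the preprocessing and update times are polynomial.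
   Context: Graph streams: the vertex set $V$ is fixed with $|V|=n$, and $n\le T\le n^{c}$ for an absolute constant $c\ge1$. An insertion-only stream is a sequence $S=(u_1,\dots,u_T)$ where each $u_t$ is either the insertion of an edge or the empty update $\bot$; $G_t$ is the simple graph on $V$ with the edges inserted in $u_1,\dots,u_t$. Two streams $S,S'$ are node-neighboring if there is a vertex $v^*$ such that at every timestep $t$ where $u_t\ne u'_t$, one of them is $\bot$ and the other is an update of an edge incident to $v^*$. A continual release algorithm outputs a value after every update; it is $\varepsilon$-node differentially private if for all node-neighboring $S,S'$ and every set $Y$ of length-$T$ output vectors, $\Pr[\mathcal A(S)\in Y]\le e^{\varepsilon}\Pr[\mathcal A(S')\in Y]$. $\mathrm{arb}(G)$ is the minimum number of forests partitioning the edges of $G$. An estimate $\tilde R$ of $R$ is a $(\beta,\zeta)$-approximation if $R-\zeta\le\tilde R\le\beta R+\zeta$. Probability $1-1/\mathrm{poly}(n)$ means at least $1-n^{-c'}$ for a constant $c'>0$. *)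

theory Defs
  imports
    "HOL-Probability.Probability"
    "HOL-Probability.SPMF"
    "HOL-Library.Log_Nat"
    "HOL-Library.Disjoint_Sets"
begin

section \<open>Graphs\<close>

text \<open>A simple graph on the vertex set \<open>{..<n}\<close> is given by its edge set, a set of two-element
  sets of vertices.\<close>

type_synonym edge = "nat set"

definition is_edge :: "nat \<Rightarrow> edge \<Rightarrow> bool" where
  "is_edge n e \<longleftrightarrow> e \<subseteq> {..<n} \<and> card e = 2"

definition is_matching :: "edge set \<Rightarrow> edge set \<Rightarrow> bool" where
  "is_matching E M \<longleftrightarrow> M \<subseteq> E \<and> pairwise disjnt M"

definition max_matching_size :: "edge set \<Rightarrow> nat" where
  "max_matching_size E = Max {card M | M. is_matching E M}"

definition is_cycle :: "edge set \<Rightarrow> nat list \<Rightarrow> bool" where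
  "is_cycle E vs \<longleftrightarrow> length vs \<ge> 3 \<and> distinct vs \<and>
     (\<forall>i<length vs. {vs ! i, vs ! (Suc i mod length vs)} \<in> E)"

definition is_forest :: "edge set \<Rightarrow> bool" where
  "is_forest E \<longleftrightarrow> (\<nexists>vs. is_cycle E vs)"

definition arboricity :: "edge set \<Rightarrow> nat" where
  "arboricity E = (LEAST k. \<exists>P. partition_on E P \<and> card P = k \<and> (\<forall>F\<in>P. is_forest F))"


section \<open>Insertion-only graph streams and node differential privacy\<close>

text \<open>\<open>Some e\<close> is the insertion of \<open>e\<close>, \<open>None\<close> is the empty update. The update \<open>u\<^sub>t\<close>,
  \<open>1 \<le> t \<le> T\<close>, is the list element with index \<open>t - 1\<close>.\<close>

type_synonym update = "edge option"

definition is_stream :: "nat \<Rightarrow> nat \<Rightarrow> update list \<Rightarrow> bool" where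
  "is_stream n T S \<longleftrightarrow> length S = T \<and> (\<forall>e. Some e \<in> set S \<longrightarrow> is_edge n e)"

definition graph_at :: "update list \<Rightarrow> nat \<Rightarrow> edge set" where
  "graph_at S t = {e. Some e \<in> set (take t S)}"

definition incident_update :: "nat \<Rightarrow> update \<Rightarrow> bool" where
  "incident_update v u \<longleftrightarrow> (\<exists>e. u = Some e \<and> v \<in> e)"

definition node_neighboring :: "nat \<Rightarrow> update list \<Rightarrow> update list \<Rightarrow> bool" where
  "node_neighboring n S S' \<longleftrightarrow> length S = length S' \<and>
     (\<exists>v<n. \<forall>i<length S. S ! i \<noteq> S' ! i \<longrightarrow>
        (S ! i = None \<and> incident_update v (S' ! i)) \<or>
        (S' ! i = None \<and> incident_update v (S ! i)))"

definition node_dp :: "nat \<Rightarrow> nat \<Rightarrow> real \<Rightarrow> (update list \<Rightarrow> 'y list spmf) \<Rightarrow> bool" where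
  "node_dp n T \<epsilon> \<A> \<longleftrightarrow>
     (\<forall>S S'. is_stream n T S \<and> is_stream n T S' \<and> node_neighboring n S S' \<longrightarrow>
        (\<forall>Y. measure (measure_spmf (\<A> S)) Y \<le> exp \<epsilon> * measure (measure_spmf (\<A> S')) Y))"

definition is_approx :: "real \<Rightarrow> real \<Rightarrow> real \<Rightarrow> real \<Rightarrow> bool" where
  "is_approx \<beta> \<zeta> R R' \<longleftrightarrow> R - \<zeta> \<le> R' \<and> R' \<le> \<beta> * R + \<zeta>"


section \<open>A randomized random-access machine\<close>

text \<open>The memory is an unbounded array of natural numbers. Programs are structured, every primitive
  instruction and every branching test takes one time step, and the only source of randomness is a
  fair coin. There is no multiplication: one step lengthens a number by at most one bit beyond
  the operands, so that the unit-cost measure is polynomially related to Turing machine time.\<close>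

type_synonym mem = "nat \<Rightarrow> nat"

datatype operand = Imm nat | Cell nat

primrec val :: "mem \<Rightarrow> operand \<Rightarrow> nat" where
  "val m (Imm k) = k"
| "val m (Cell a) = m a"

datatype com =
    Skip
  | Add nat operand operand
  | Sub nat operand operand   \<comment> \<open>truncated subtraction\<close>
  | Half nat operand
  | Load nat operand          \<comment> \<open>indirect read: \<open>m[a] := m[m[x]]\<close> for \<open>Load a (Cell x)\<close>\<close>
  | Store operand operand     \<comment> \<open>indirect write: \<open>m[m[x]] := m[y]\<close> for \<open>Store (Cell x) (Cell y)\<close>\<close>
  | Coin nat
  | Seq com com
  | If nat com com            \<comment> \<open>tests whether the cell is nonzero\<close>
  | While nat com

text \<open>Space is counted in bits. All cells up to the last nonzero one are charged, including those
  that contain 0, so that no information can be hidden in the addresses of the cells in use.\<close>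

definition mem_bits :: "mem \<Rightarrow> nat" where
  "mem_bits m = (\<Sum>i<(LEAST L. \<forall>j\<ge>L. m j = 0). 1 + floorlog 2 (m i))"

text \<open>An execution yields the final memory, the number of steps and the peak space. The missing
  mass of the subprobability distribution is the probability of divergence.\<close>

type_synonym result = "mem \<times> nat \<times> nat"

definition tick :: "mem \<Rightarrow> mem \<Rightarrow> result" where
  "tick m m' = (m', 1, max (mem_bits m) (mem_bits m'))"

definition and_then :: "result spmf \<Rightarrow> (mem \<Rightarrow> result spmf) \<Rightarrow> result spmf" where
  "and_then p f = bind_spmf p (\<lambda>(m, t, s). map_spmf (\<lambda>(m', t', s'). (m', t + t', max s s')) (f m))"

lemma and_then_mono [partial_function_mono]:
  assumes "mono_spmf F" and "\<And>m. mono_spmf (\<lambda>f. G m f)"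
  shows "mono_spmf (\<lambda>f. and_then (F f) (\<lambda>m. G m f))"
  unfolding and_then_def map_spmf_conv_bind_spmf case_prod_beta
  by (intro bind_spmf_mono assms) (auto intro!: monotoneI)

partial_function (spmf) loop :: "nat \<Rightarrow> (mem \<Rightarrow> result spmf) \<Rightarrow> mem \<Rightarrow> result spmf" where
  "loop a body m =
     and_then (return_spmf (tick m m))
       (\<lambda>m. if m a = 0 then return_spmf (m, 0, 0) else and_then (body m) (loop a body))"

primrec exec :: "com \<Rightarrow> mem \<Rightarrow> result spmf" where
  "exec Skip m = return_spmf (tick m m)"
| "exec (Add a x y) m = return_spmf (tick m (m(a := val m x + val m y)))"
| "exec (Sub a x y) m = return_spmf (tick m (m(a := val m x - val m y)))"
| "exec (Half a x) m = return_spmf (tick m (m(a := val m x div 2)))"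
| "exec (Load a x) m = return_spmf (tick m (m(a := m (val m x))))"
| "exec (Store x y) m = return_spmf (tick m (m(val m x := val m y)))"
| "exec (Coin a) m =
     map_spmf (\<lambda>b. tick m (m(a := (if b then 1 else 0)))) (spmf_of_pmf (bernoulli_pmf (1/2)))"
| "exec (Seq c d) m = and_then (exec c m) (exec d)"
| "exec (If a c d) m = and_then (return_spmf (tick m m)) (if m a \<noteq> 0 then exec c else exec d)"
| "exec (While a c) m = loop a (exec c) m"


section \<open>Continual release algorithms\<close>

text \<open>An algorithm consists of a preprocessing program and an update program. Cells 0, 1, 2 initially
  hold the public parameters \<open>n\<close>, \<open>T\<close> and the arboricity bound. Before each run of the update program
  the endpoints of the current edge are written to cells 3 and 4 (twice the value 0 for the empty
  update), and afterwards the content of cell 5 is released. The memory persists between updates;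
  the stream itself is not accessible.\<close>

datatype alg = Alg (preprocessing: com) (updating: com)

definition init_mem :: "nat \<Rightarrow> nat \<Rightarrow> nat \<Rightarrow> mem" where
  "init_mem n T a = (\<lambda>_. 0)(0 := n, 1 := T, 2 := a)"

fun feed :: "update \<Rightarrow> mem \<Rightarrow> mem" where
  "feed None m = m(3 := 0, 4 := 0)"
| "feed (Some e) m = m(3 := Min e, 4 := Max e)"

text \<open>For every update: the released value, the update time and the peak space during the update.\<close>

primrec process :: "com \<Rightarrow> update list \<Rightarrow> mem \<Rightarrow> (nat \<times> nat \<times> nat) list spmf" where
  "process c [] m = return_spmf []"
| "process c (u # us) m =
     bind_spmf (exec c (feed u m)) (\<lambda>(m', t, s). map_spmf (\<lambda>rs. (m' 5, t, s) # rs) (process c us m'))"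

text \<open>The first two components are time and peak space of the preprocessing.\<close>

definition run :: "alg \<Rightarrow> nat \<Rightarrow> nat \<Rightarrow> nat \<Rightarrow> update list \<Rightarrow> (nat \<times> nat \<times> (nat \<times> nat \<times> nat) list) spmf" where
  "run A n T a S =
     bind_spmf (exec (preprocessing A) (init_mem n T a))
       (\<lambda>(m, t, s). map_spmf (\<lambda>rs. (t, s, rs)) (process (updating A) S m))"

definition released :: "alg \<Rightarrow> nat \<Rightarrow> nat \<Rightarrow> nat \<Rightarrow> update list \<Rightarrow> nat list spmf" where
  "released A n T a S = map_spmf (\<lambda>(t, s, rs). map fst rs) (run A n T a S)"

text \<open>The bounds below hold for every outcome of the coin flips.\<close>

definition always_halts :: "alg \<Rightarrow> nat \<Rightarrow> nat \<Rightarrow> nat \<Rightarrow> update list \<Rightarrow> bool" where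
  "always_halts A n T a S \<longleftrightarrow> lossless_spmf (run A n T a S)"

definition space_le :: "alg \<Rightarrow> nat \<Rightarrow> nat \<Rightarrow> nat \<Rightarrow> update list \<Rightarrow> real \<Rightarrow> bool" where
  "space_le A n T a S B \<longleftrightarrow>
     (\<forall>(t\<^sub>0, s\<^sub>0, rs) \<in> set_spmf (run A n T a S). real s\<^sub>0 \<le> B \<and> (\<forall>(y, t, s) \<in> set rs. real s \<le> B))"

definition preprocessing_time_le :: "alg \<Rightarrow> nat \<Rightarrow> nat \<Rightarrow> nat \<Rightarrow> update list \<Rightarrow> real \<Rightarrow> bool" where
  "preprocessing_time_le A n T a S B \<longleftrightarrow>
     (\<forall>(t\<^sub>0, s\<^sub>0, rs) \<in> set_spmf (run A n T a S). real t\<^sub>0 \<le> B)"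

definition update_time_le :: "alg \<Rightarrow> nat \<Rightarrow> nat \<Rightarrow> nat \<Rightarrow> update list \<Rightarrow> real \<Rightarrow> bool" where
  "update_time_le A n T a S B \<longleftrightarrow>
     (\<forall>(t\<^sub>0, s\<^sub>0, rs) \<in> set_spmf (run A n T a S). \<forall>(y, t, s) \<in> set rs. real t \<le> B)"

text \<open>The usual convention that a logarithm inside an asymptotic bound is at least 1; without it the
  space bound would read 0 when the arboricity bound and \<open>\<eta>\<close> are both 1.\<close>

definition log1 :: "real \<Rightarrow> real" where
  "log1 x = max 1 (log 2 x)"

end

theory Submission
  imports Defs
begin

text \<open>
  The size \<open>g\<close> of the greedy matching of an insertion-only stream satisfies \<open>g \<le> M(G) \<le> 2 g\<close>, takes one
  bit per vertex to maintain, and changes by at most 1 at every time when the edges at one vertex are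
  inserted or deleted, because the two runs differ by an alternating path. It is released by a sparse vector
  mechanism: the output is \<open>2 q\<close>, where \<open>q\<close> runs through \<open>O(log n)\<close> levels that grow by a factor of about 3/2,
  so that the output is at most three times the lower end of the current level.

  Pure privacy with fair coins in bounded time is obtained as follows. Let \<open>r = 1 - 1/k\<close> for a power of two \<open>k\<close>.
  The noise \<open>\<rho>\<close> is the number of successes, capped at \<open>B\<close>, before the first failure in trials with success
  probability \<open>r\<close>. At every step the level is raised with probability \<open>r ^ X\<close>, where \<open>X\<close> is the distance of the
  noisy threshold \<open>b (q + 1) + \<rho>\<close> from \<open>b g + D\<close>, clipped to \<open>[0, D]\<close>. For a neighbouring stream, replace
  \<open>\<rho>\<close> by \<open>\<rho> + b\<close>: then not raising becomes at least as likely and every raise loses at most a factor of \<open>r ^ (2 b)\<close>,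
  while the shift itself costs \<open>r ^ b\<close>. The cap \<open>B\<close> does no harm, since \<open>X = D\<close> whatever the
  stream is once \<open>\<rho> \<ge> 2 D + b n\<close>. Outside an event of probability \<open>(T + 1) r ^ D\<close> the noise is below \<open>D\<close> and no raise
  happens while \<open>X = D\<close>.
\<close>

section \<open>Time, space and output distribution of programs\<close>

text \<open>Programs are compared with distributions of abstract outcomes by couplings that also carry the
  resource bounds; \<open>I\<close> is an invariant of all memories that occur.\<close>

locale space_bound =
  fixes I :: "mem \<Rightarrow> bool" and \<sigma> :: nat
  assumes mem_bits_le: "I m \<Longrightarrow> mem_bits m \<le> \<sigma>"
begin

text \<open>Since \<open>spmf_of_pmf p\<close> has full mass, such a coupling also forces the
  program to terminate with probability one, and a bound carried by it holds for every outcome of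
  the coins.\<close>

definition sim :: "com \<Rightarrow> mem \<Rightarrow> nat \<Rightarrow> 'a pmf \<Rightarrow> (mem \<Rightarrow> 'a \<Rightarrow> bool) \<Rightarrow> bool" where
  "sim c m \<tau> p R \<longleftrightarrow>
     rel_spmf (\<lambda>(m', t, s) y. I m' \<and> R m' y \<and> t \<le> \<tau> \<and> s \<le> \<sigma>) (exec c m) (spmf_of_pmf p)"

lemma rel_spmf_and_then:
  assumes "rel_spmf (\<lambda>(m, t, s) y. R m y \<and> t \<le> \<tau>\<^sub>1 \<and> s \<le> \<sigma>) p (spmf_of_pmf q)"
    and "\<And>m y. R m y \<Longrightarrow>
      rel_spmf (\<lambda>(m', t, s) z. R' m' z \<and> t \<le> \<tau>\<^sub>2 \<and> s \<le> \<sigma>) (f m) (spmf_of_pmf (h y))"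
  shows "rel_spmf (\<lambda>(m', t, s) z. R' m' z \<and> t \<le> \<tau>\<^sub>1 + \<tau>\<^sub>2 \<and> s \<le> \<sigma>)
    (and_then p f) (spmf_of_pmf (bind_pmf q h))"
proof -
  have eq: "spmf_of_pmf (bind_pmf q h) = bind_spmf (spmf_of_pmf q) (\<lambda>y. spmf_of_pmf (h y))"
    by (simp add: spmf_of_pmf_bind)
  show ?thesis
    unfolding and_then_def eq
    by (rule rel_spmf_bindI[OF assms(1)])
       (auto simp: spmf_rel_map intro!: rel_spmf_mono[OF assms(2)])
qed

lemma sim_mono:
  assumes "sim c m \<tau> p R" and "\<tau> \<le> \<tau>'" and "\<And>m' y. I m' \<Longrightarrow> R m' y \<Longrightarrow> R' m' y"
  shows "sim c m \<tau>' p R'"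
  using assms(1) unfolding sim_def
  by (rule rel_spmf_mono) (use assms(2,3) in auto)

lemma sim_map:
  assumes "sim c m \<tau> p (\<lambda>m' y. R m' (f y))"
  shows "sim c m \<tau> (map_pmf f p) R"
proof -
  have "spmf_of_pmf (map_pmf f p) = map_spmf f (spmf_of_pmf p)" by simp
  then show ?thesis
    using assms unfolding sim_def
    by (simp add: spmf_rel_map split_def del: map_spmf_of_pmf)
qed

lemma sim_tick:
  assumes "exec c m = return_spmf (tick m m')" and "I m" and "I m'" and "R m' y"
  shows "sim c m (Suc 0) (return_pmf y) R"
  using assms by (simp add: sim_def tick_def mem_bits_le)

lemma sim_Seq:
  assumes "sim c m \<tau>\<^sub>1 p R" and "\<And>m' y. I m' \<Longrightarrow> R m' y \<Longrightarrow> sim d m' \<tau>\<^sub>2 (h y) R'"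
  shows "sim (Seq c d) m (\<tau>\<^sub>1 + \<tau>\<^sub>2) (bind_pmf p h) R'"
  using rel_spmf_and_then[where R = "\<lambda>m y. I m \<and> R m y" and R' = "\<lambda>m y. I m \<and> R' m y"] assms
  unfolding sim_def by (simp add: conj_assoc)

lemma sim_Seq_tick:
  assumes "exec c m = return_spmf (tick m m')" and "I m" and "I m'" and "sim d m' \<tau> p R"
  shows "sim (Seq c d) m (Suc \<tau>) p R"
  using sim_Seq[OF sim_tick[OF assms(1-3), where R = "\<lambda>m'' _. m'' = m'" and y = "()"],
      where h = "\<lambda>_. p" and d = d] assms(4)
  by (simp add: bind_return_pmf)

lemma sim_Seq_det:
  assumes "sim c m \<tau>\<^sub>1 (return_pmf ()) (\<lambda>m' _. Q m')"
    and "\<And>m'. I m' \<Longrightarrow> Q m' \<Longrightarrow> sim d m' \<tau>\<^sub>2 p R"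
  shows "sim (Seq c d) m (\<tau>\<^sub>1 + \<tau>\<^sub>2) p R"
  using sim_Seq[OF assms(1), where h = "\<lambda>_. p"] assms(2) by (simp add: bind_return_pmf)

text \<open>The branch budgets are added instead of taking their maximum, so that time bounds stay
  linear sums; only their polynomial order matters.\<close>

lemma sim_If:
  assumes "I m" and "m x \<noteq> 0 \<Longrightarrow> sim c m \<tau>\<^sub>1 p R" and "m x = 0 \<Longrightarrow> sim d m \<tau>\<^sub>2 p R"
  shows "sim (If x c d) m (Suc (\<tau>\<^sub>1 + \<tau>\<^sub>2)) p R"
proof -
  define \<tau> where "\<tau> = \<tau>\<^sub>1 + \<tau>\<^sub>2"
  have br: "m x \<noteq> 0 \<Longrightarrow> sim c m \<tau> p R" "m x = 0 \<Longrightarrow> sim d m \<tau> p R"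
    using sim_mono[OF assms(2)] sim_mono[OF assms(3)] by (auto simp: \<tau>_def)
  have "rel_spmf (\<lambda>(m', t, s) z. (I m' \<and> R m' z) \<and> t \<le> 1 + \<tau> \<and> s \<le> \<sigma>)
    (and_then (return_spmf (tick m m)) (if m x \<noteq> 0 then exec c else exec d))
    (spmf_of_pmf (bind_pmf (return_pmf ()) (\<lambda>_. p)))"
    by (rule rel_spmf_and_then[where R = "\<lambda>m' _. m' = m"])
       (use assms(1) br in \<open>auto simp: tick_def mem_bits_le sim_def conj_assoc\<close>)
  then show ?thesis by (simp add: sim_def bind_return_pmf conj_assoc flip: \<tau>_def)
qed

lemma sim_While_exit:
  assumes "I m" and "m x = 0" and "R m y"
  shows "sim (While x c) m (Suc 0) (return_pmf y) R"
  using assms by (simp add: sim_def loop.simps and_then_def tick_def mem_bits_le)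

text \<open>The least fixed point \<open>loop\<close> is unfolded once. Loops are later handled by
  induction on a counter with this rule and \<open>sim_While_exit\<close>, so termination needs no
  separate argument.\<close>

lemma sim_While_step:
  assumes "I m" and "m x \<noteq> 0" and "sim c m \<tau>\<^sub>1 p R"
    and "\<And>m' y. I m' \<Longrightarrow> R m' y \<Longrightarrow> sim (While x c) m' \<tau>\<^sub>2 (h y) R'"
  shows "sim (While x c) m (Suc (\<tau>\<^sub>1 + \<tau>\<^sub>2)) (bind_pmf p h) R'"
proof -
  have "rel_spmf (\<lambda>(m', t, s) z. (I m' \<and> R' m' z) \<and> t \<le> \<tau>\<^sub>1 + \<tau>\<^sub>2 \<and> s \<le> \<sigma>)
    (and_then (exec c m) (loop x (exec c))) (spmf_of_pmf (bind_pmf p h))"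
    by (rule rel_spmf_and_then[where R = "\<lambda>m' y. I m' \<and> R m' y"])
       (use assms in \<open>auto simp: sim_def conj_assoc\<close>)
  then have "rel_spmf (\<lambda>(m', t, s) z. (I m' \<and> R' m' z) \<and> t \<le> 1 + (\<tau>\<^sub>1 + \<tau>\<^sub>2) \<and> s \<le> \<sigma>)
    (and_then (return_spmf (tick m m)) (\<lambda>m. if m x = 0 then return_spmf (m, 0, 0) else
       and_then (exec c m) (loop x (exec c))))
    (spmf_of_pmf (bind_pmf (return_pmf ()) (\<lambda>_. bind_pmf p h)))"
    by (intro rel_spmf_and_then[where R = "\<lambda>m' _. m' = m"])
       (use assms in \<open>auto simp: tick_def mem_bits_le\<close>)
  then show ?thesis
    unfolding sim_def exec.simps by (subst loop.simps) (simp add: bind_return_pmf conj_assoc)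
qed

lemma sim_Coin:
  assumes "I m" and "I (m(x := 0))" and "I (m(x := 1))"
    and "R (m(x := 0)) False" and "R (m(x := 1)) True"
  shows "sim (Coin x) m (Suc 0) (bernoulli_pmf (1/2)) R"
proof -
  have "rel_spmf (\<lambda>x y. x = y) (spmf_of_pmf (bernoulli_pmf (1/2))) (spmf_of_pmf (bernoulli_pmf (1/2)))"
    by (intro rel_spmf_reflI) simp
  then show ?thesis
    unfolding sim_def exec.simps spmf_rel_map
    by (rule rel_spmf_mono) (use assms in \<open>auto simp: tick_def mem_bits_le\<close>)
qed

end

text \<open>Turns a coupling into a worst-case bound over all coin outcomes.\<close>

lemma rel_spmf_setD1:
  assumes "rel_spmf P p q" and "x \<in> set_spmf p"
  shows "\<exists>y. P x y"
  using assms by (elim rel_spmfE) fastforce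

section \<open>The sparse vector mechanism\<close>

lemma measure_bind_bernoulli:
  assumes "0 \<le> p" and "p \<le> 1"
  shows "measure (measure_pmf (bind_pmf (bernoulli_pmf p) f)) Y =
    p * measure (measure_pmf (f True)) Y + (1 - p) * measure (measure_pmf (f False)) Y"
proof -
  have "measure (measure_pmf (bind_pmf (bernoulli_pmf p) f)) Y
      = (LINT s|measure_pmf (bernoulli_pmf p). measure (measure_pmf (f s)) Y)"
    by (subst measure_pmf_bind)
       (rule subprob_space.measure_bind[where N = "count_space UNIV"],
        auto simp: measure_pmf.subprob_space_axioms measure_pmf_in_subprob_algebra)
  also have "\<dots> = p * measure (measure_pmf (f True)) Y + (1 - p) * measure (measure_pmf (f False)) Y"
    using assms by (simp add: mult.commute)
  finally show ?thesis .
qed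

lemma bind_bernoulli_conj:
  assumes "0 \<le> p" "p \<le> 1" "0 \<le> q" "q \<le> 1"
  shows "bind_pmf (bernoulli_pmf p) (\<lambda>s. if s then bernoulli_pmf q else return_pmf False)
    = bernoulli_pmf (p * q)"
proof (rule pmf_eqI)
  fix s
  have pq: "p * q \<le> 1" using assms by (simp add: mult_le_one)
  show "pmf (bind_pmf (bernoulli_pmf p) (\<lambda>s. if s then bernoulli_pmf q else return_pmf False)) s
    = pmf (bernoulli_pmf (p * q)) s"
    using assms pq by (cases s) (simp_all add: pmf_bind algebra_simps)
qed

text \<open>One more fair coin halves the probability that no coin has shown heads so far; iterated,
  this gives the bias \<open>1 - (1/2) ^ j\<close> of \<open>flip\<close>.\<close>

lemma bind_bernoulli_disj:
  assumes "0 \<le> p" "p \<le> 1"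
  shows "bind_pmf (bernoulli_pmf (1/2)) (\<lambda>s. map_pmf (\<lambda>y. s \<or> y) (bernoulli_pmf (1 - p)))
    = bernoulli_pmf (1 - p * (1/2))"
proof (rule pmf_eqI)
  fix s
  have or_simps: "(\<or>) False = (\<lambda>y. y)" "(\<or>) True = (\<lambda>y. True)" by auto
  show "pmf (bind_pmf (bernoulli_pmf (1/2)) (\<lambda>s. map_pmf (\<lambda>y. s \<or> y) (bernoulli_pmf (1 - p)))) s
    = pmf (bernoulli_pmf (1 - p * (1/2))) s"
    using assms by (cases s) (simp_all add: pmf_bind or_simps field_simps)
qed

text \<open>The geometric distribution with the mass of all values beyond the cap moved onto the
  cap. The recursion over the number of remaining trials is that of the loop in
  \<open>sample\<close>.\<close>

fun geo :: "real \<Rightarrow> nat \<Rightarrow> nat pmf" where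
  "geo r 0 = return_pmf 0"
| "geo r (Suc N) =
     bind_pmf (bernoulli_pmf r) (\<lambda>s. if s then map_pmf Suc (geo r N) else return_pmf 0)"

text \<open>Expectation of \<open>F\<close> under \<open>geo r N\<close>, in recursive form:
  inequalities between such expectations then follow by induction over the cap, without
  integrals.\<close>

fun geo_mean :: "real \<Rightarrow> nat \<Rightarrow> (nat \<Rightarrow> real) \<Rightarrow> real" where
  "geo_mean r 0 F = F 0"
| "geo_mean r (Suc N) F = (1 - r) * F 0 + r * geo_mean r N (\<lambda>i. F (Suc i))"

text \<open>All \<open>N\<close> trials succeed exactly when the cap is reached. Thus an event of
  probability \<open>r ^ N\<close> is produced by sampling, without computing a power.\<close>

lemma geo_full:
  assumes "0 \<le> r" and "r \<le> 1"
  shows "map_pmf (\<lambda>i. i = N) (geo r N) = bernoulli_pmf (r ^ N)"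
proof (induction N)
  case 0
  show ?case by (rule pmf_eqI) (case_tac i; simp)
next
  case (Suc N)
  have "map_pmf (\<lambda>i. i = Suc N) (geo r (Suc N)) =
      bind_pmf (bernoulli_pmf r) (\<lambda>s. if s then map_pmf (\<lambda>i. i = N) (geo r N) else return_pmf False)"
    by (auto simp: map_bind_pmf pmf.map_comp o_def intro!: bind_pmf_cong)
  then show ?case
    using assms by (simp only: Suc) (simp add: bind_bernoulli_conj power_le_one)
qed

lemma measure_bind_geo:
  assumes "0 \<le> r" and "r \<le> 1"
  shows "measure (measure_pmf (bind_pmf (geo r N) f)) Y = geo_mean r N (\<lambda>i. measure (measure_pmf (f i)) Y)"
proof (induction N arbitrary: f)
  case 0
  show ?case by (simp add: bind_return_pmf)
next
  case (Suc N)
  have "bind_pmf (geo r (Suc N)) f =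
      bind_pmf (bernoulli_pmf r) (\<lambda>s. if s then bind_pmf (geo r N) (\<lambda>i. f (Suc i)) else f 0)"
    by (auto simp: bind_assoc_pmf bind_map_pmf bind_return_pmf intro!: bind_pmf_cong)
  then show ?case
    using assms by (simp add: measure_bind_bernoulli Suc)
qed

lemma geo_mean_mono:
  assumes "0 \<le> r" and "r \<le> 1" and "\<And>i. F i \<le> G i"
  shows "geo_mean r N F \<le> geo_mean r N G"
  using assms by (induction N arbitrary: F G) (auto intro!: add_mono mult_left_mono)

lemma geo_mean_nonneg:
  assumes "0 \<le> r" and "r \<le> 1" and "\<And>i. 0 \<le> F i"
  shows "0 \<le> geo_mean r N F"
  using assms by (induction N arbitrary: F) auto

lemma geo_mean_scale: "geo_mean r N (\<lambda>i. c * F i) = c * geo_mean r N F"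
  by (induction N arbitrary: F) (auto simp: algebra_simps)

text \<open>The cap \<open>N\<close> carries mass \<open>r ^ N\<close>, which the cap
  \<open>Suc N\<close> splits between two points at which \<open>F\<close> agrees.\<close>

lemma geo_mean_eq_Suc:
  assumes "F (Suc N) = F N"
  shows "geo_mean r (Suc N) F = geo_mean r N F"
  using assms
proof (induction N arbitrary: F)
  case (Suc N)
  show ?case
    using Suc.IH[of "\<lambda>i. F (Suc i)"] Suc.prems by (simp del: geo_mean.simps(2) add: geo_mean.simps(2)[of r _ F])
qed (simp add: algebra_simps)

text \<open>Memorylessness: removing one initial success costs a factor \<open>r\<close>. The
  truncation is repaired by the constancy of \<open>F\<close> from the cap on, which lets the cap be
  lowered by one for free; what remains is the success branch of the recursion.\<close>

lemma geo_mean_shift: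
  assumes "0 \<le> r" and "r \<le> 1" and "\<And>i. 0 \<le> F i" and "\<And>i. N \<le> i \<Longrightarrow> F i = F N"
  shows "r ^ j * geo_mean r N (\<lambda>i. F (i + j)) \<le> geo_mean r N F"
proof (induction j)
  case (Suc j)
  define G where "G = (\<lambda>i. F (i + j))"
  have "r * geo_mean r N (\<lambda>i. G (Suc i)) \<le> geo_mean r N G"
  proof (cases N)
    case 0
    have "r * F (Suc j) \<le> 1 * F (Suc j)"
      using assms by (intro mult_right_mono) auto
    then show ?thesis using assms(4)[of "Suc j"] assms(4)[of j] 0 by (simp add: G_def)
  next
    case (Suc N')
    have "G (Suc (Suc N')) = G (Suc N')"
      using assms(4)[of "Suc (Suc N') + j"] assms(4)[of "Suc N' + j"] Suc by (simp add: G_def)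
    then have "geo_mean r N (\<lambda>i. G (Suc i)) = geo_mean r N' (\<lambda>i. G (Suc i))"
      unfolding Suc by (intro geo_mean_eq_Suc)
    moreover have "0 \<le> (1 - r) * G 0" using assms by (simp add: G_def)
    ultimately show ?thesis by (simp add: Suc)
  qed
  then have "r ^ j * (r * geo_mean r N (\<lambda>i. G (Suc i))) \<le> r ^ j * geo_mean r N G"
    using assms by (intro mult_left_mono) auto
  then show ?case using Suc by (simp add: G_def mult.assoc mult.left_commute)
qed simp

text \<open>The noise is below \<open>j\<close> with probability \<open>1 - r ^ j\<close>, because
  \<open>j \<le> N\<close> keeps the cap out of this range; elsewhere nonnegativity is
  enough.\<close>

lemma geo_mean_ge:
  assumes "0 \<le> r" and "r \<le> 1" and "\<And>i. 0 \<le> F i" and "\<And>i. i < j \<Longrightarrow> v \<le> F i" and "j \<le> N"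
  shows "(1 - r ^ j) * v \<le> geo_mean r N F"
  using assms(3-)
proof (induction j arbitrary: N F)
  case 0
  then show ?case using geo_mean_nonneg[OF assms(1,2), of F N] by simp
next
  case (Suc j)
  then obtain N' where N: "N = Suc N'" and "j \<le> N'" by (cases N) auto
  have "(1 - r ^ j) * v \<le> geo_mean r N' (\<lambda>i. F (Suc i))"
    using Suc.prems \<open>j \<le> N'\<close> by (intro Suc.IH) auto
  then have "r * ((1 - r ^ j) * v) \<le> r * geo_mean r N' (\<lambda>i. F (Suc i))"
    using assms(1) by (intro mult_left_mono)
  moreover have "(1 - r) * v \<le> (1 - r) * F 0"
    using Suc.prems(2)[of 0] assms(2) by (intro mult_left_mono) auto
  ultimately show ?case by (simp add: N algebra_simps)
qed

section \<open>Levels and the noisy threshold test\<close>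

text \<open>This is 3/2 times \<open>q + 1\<close>, rounded down. It exceeds \<open>q\<close> even
  at 0, and \<open>2 * next_level q \<le> 3 * (q + 1)\<close> ties the output after a raise to the
  value \<open>q + 1\<close> that was tested.\<close>

definition next_level :: "nat \<Rightarrow> nat" where
  "next_level q = (q + 1) + (q + 1) div 2"

text \<open>Two raises at least double \<open>q + 2\<close>, so logarithmically many raises take the
  level to \<open>n\<close>; this bounds how often privacy is paid for.\<close>

lemma next_level_funpow_ge: "2 * 2 ^ i \<le> (next_level ^^ (2 * i)) 0 + 2"
proof (induction i)
  case (Suc i)
  have "2 * (q + 2) \<le> next_level (next_level q) + 2" for q
    unfolding next_level_def by presburger
  from this[of "(next_level ^^ (2 * i)) 0"] Suc show ?case by simp
qed simp

locale sparse_vector =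
  fixes n b D :: nat and r :: real
  assumes r_pos: "0 < r" and r_le_1: "r \<le> 1" and D_pos: "0 < D"
begin

text \<open>The nested truncated subtractions clip \<open>b * (q + 1) + \<rho> - (b * g + D)\<close>
  to the interval from 0 to \<open>D\<close>, and they are available as machine
  instructions.\<close>

definition expo :: "nat \<Rightarrow> nat \<Rightarrow> nat \<Rightarrow> nat" where
  "expo \<rho> q g = D - ((b * g + 2 * D) - (b * (q + 1) + \<rho>))"

text \<open>A level of at least \<open>n\<close> is frozen: no count exceeds it, and all later
  outputs are determined.\<close>

definition step :: "nat \<Rightarrow> nat \<Rightarrow> nat \<Rightarrow> nat pmf" where
  "step \<rho> q g = (if n \<le> q then return_pmf q else
     map_pmf (\<lambda>s. if s then next_level q else q) (bernoulli_pmf (r ^ expo \<rho> q g)))"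

fun levels :: "nat \<Rightarrow> nat \<Rightarrow> nat list \<Rightarrow> nat list pmf" where
  "levels \<rho> q [] = return_pmf []"
| "levels \<rho> q (g # gs) =
     bind_pmf (step \<rho> q g) (\<lambda>q'. map_pmf ((#) (2 * q')) (levels \<rho> q' gs))"

lemma power_r: "0 < r ^ i" "r ^ i \<le> 1"
  using r_pos r_le_1 by (auto intro: power_le_one)

lemma le_inverse_power_mult: "0 \<le> x \<Longrightarrow> x \<le> (1 / r) ^ i * x"
  using mult_right_mono[of 1 "(1 / r) ^ i" x] one_le_power[of "1 / r" i] r_pos r_le_1 by simp

lemma levels_final: "n \<le> q \<Longrightarrow> levels \<rho> q gs = return_pmf (replicate (length gs) (2 * q))"
  by (induction gs) (auto simp: step_def bind_return_pmf)

lemma measure_levels_Cons: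
  assumes "q < n"
  shows "measure (measure_pmf (levels \<rho> q (g # gs))) Y =
     r ^ expo \<rho> q g * measure (measure_pmf (levels \<rho> (next_level q) gs)) {ys. 2 * next_level q # ys \<in> Y}
     + (1 - r ^ expo \<rho> q g) * measure (measure_pmf (levels \<rho> q gs)) {ys. 2 * q # ys \<in> Y}"
  using assms power_r[of "expo \<rho> q g"]
  by (simp add: step_def bind_map_pmf measure_bind_bernoulli vimage_def)

section \<open>Privacy of the level process\<close>

text \<open>\<open>j\<close> is a number of raises that certainly leads to a frozen level. Induction
  over the stream charges \<open>(1 / r) ^ (2 * b)\<close> to a raise and nothing to a step without
  one, so the loss depends on the number of levels and not on the length of the stream.\<close>

lemma levels_private:
  assumes "list_all2 (\<lambda>g g'. g \<le> g' + 1 \<and> g' \<le> g + 1) gs gs'" and "n \<le> (next_level ^^ j) q"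
  shows "measure (measure_pmf (levels \<rho> q gs)) Y
    \<le> (1 / r) ^ (2 * b * j) * measure (measure_pmf (levels (\<rho> + b) q gs')) Y"
  using assms
proof (induction gs gs' arbitrary: q j Y rule: list_all2_induct)
  case Nil
  show ?case using le_inverse_power_mult[of "indicator Y []"] by simp
next
  case (Cons g gs g' gs')
  show ?case
  proof (cases "n \<le> q")
    case True
    have len: "length gs = length gs'" using Cons.hyps by (simp add: list_all2_lengthD)
    show ?thesis
      by (simp only: levels_final[OF True] list.size len) (rule le_inverse_power_mult, simp)
  next
    case False
    then have q: "q < n" by simp
    obtain i where j: "j = Suc i"
      using Cons.prems q by (cases j) auto
    let ?e = "expo \<rho> q g" and ?e' = "expo (\<rho> + b) q g'"
    let ?L = "\<lambda>\<rho> q' gs. measure (measure_pmf (levels \<rho> q' gs)) {ys. 2 * q' # ys \<in> Y}"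
    have g: "b * g \<le> b * g' + b" "b * g' \<le> b * g + b"
      using Cons.hyps(1) mult_le_mono2[of g "g' + 1" b] mult_le_mono2[of g' "g + 1" b]
      by (simp_all add: add.commute)
    \<comment> \<open>The shift of the noise by \<open>b\<close> outweighs the change of
      \<open>b * g\<close> by at most \<open>b\<close>: the distance cannot decrease, and it grows
      by at most \<open>2 * b\<close>.\<close>
    have "D - (x + 2 * D - (y + \<rho>)) \<le> D - (x' + 2 * D - (y + (\<rho> + b)))"
      "D - (x' + 2 * D - (y + (\<rho> + b))) \<le> D - (x + 2 * D - (y + \<rho>)) + 2 * b"
      if "x \<le> x' + b" "x' \<le> x + b" for x x' y
      using that by linarith+
    from this[OF g] have "?e \<le> ?e'" "?e' \<le> ?e + 2 * b"
      unfolding expo_def by auto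
    then have stay: "r ^ ?e' \<le> r ^ ?e" and "r ^ (?e + 2 * b) \<le> r ^ ?e'"
      using r_pos r_le_1 by (auto intro!: power_decreasing)
    then have cross: "r ^ ?e \<le> (1 / r) ^ (2 * b) * r ^ ?e'"
      using r_pos by (simp add: power_add field_simps)
    have "?L \<rho> (next_level q) gs \<le> (1 / r) ^ (2 * b * i) * ?L (\<rho> + b) (next_level q) gs'"
      using Cons.prems by (intro Cons.IH) (simp add: j funpow_swap1)
    then have "r ^ ?e * ?L \<rho> (next_level q) gs \<le>
        ((1 / r) ^ (2 * b) * r ^ ?e') * ((1 / r) ^ (2 * b * i) * ?L (\<rho> + b) (next_level q) gs')"
      using cross r_pos by (intro mult_mono) auto
    also have "\<dots> = (1 / r) ^ (2 * b * j) * (r ^ ?e' * ?L (\<rho> + b) (next_level q) gs')"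
      by (simp add: j power_add)
    finally have 1: "r ^ ?e * ?L \<rho> (next_level q) gs \<le> \<dots>" .
    have "?L \<rho> q gs \<le> (1 / r) ^ (2 * b * j) * ?L (\<rho> + b) q gs'"
      using Cons.prems by (intro Cons.IH)
    \<comment> \<open>The larger exponent makes staying more likely on the right-hand side, so this
      branch only passes on the factor from the induction hypothesis.\<close>
    then have "(1 - r ^ ?e) * ?L \<rho> q gs \<le> (1 - r ^ ?e') * ((1 / r) ^ (2 * b * j) * ?L (\<rho> + b) q gs')"
      using stay power_r[of ?e'] by (intro mult_mono) auto
    then show ?thesis
      using 1 by (simp del: levels.simps add: measure_levels_Cons[OF q] distrib_left mult.left_commute)
  qed
qed

text \<open>With this much noise the threshold is at least \<open>b * g + 2 * D\<close> for every
  \<open>g \<le> n\<close>, so the exponent is \<open>D\<close> at every step. This is the constancy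
  that \<open>geo_mean_shift\<close> asks for at the cap.\<close>

lemma levels_saturated:
  assumes "\<forall>g\<in>set gs. g \<le> n" and "2 * D + b * n \<le> \<rho>" and "2 * D + b * n \<le> \<rho>'"
  shows "levels \<rho> q gs = levels \<rho>' q gs"
  using assms(1)
proof (induction gs arbitrary: q)
  case (Cons g gs)
  have "b * g \<le> b * n" using Cons.prems by auto
  then have "b * g + 2 * D \<le> b * (q + 1) + \<rho>" "b * g + 2 * D \<le> b * (q + 1) + \<rho>'"
    using assms(2,3) by linarith+
  then have "expo \<rho> q g = expo \<rho>' q g" unfolding expo_def by (metis diff_is_0_eq)
  then have "step \<rho> q g = step \<rho>' q g" by (simp add: step_def)
  then show ?case using Cons by simp
qed simp

text \<open>The exponent adds \<open>b\<close> for the shift of the noise to \<open>2 * b\<close>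
  for each of at most \<open>j\<close> raises.\<close>

lemma noisy_levels_private:
  assumes "list_all2 (\<lambda>g g'. g \<le> g' + 1 \<and> g' \<le> g + 1) gs gs'" and "n \<le> (next_level ^^ j) q"
    and "\<forall>g\<in>set gs'. g \<le> n" and "2 * D + b * n \<le> B"
  shows "measure (measure_pmf (bind_pmf (geo r B) (\<lambda>\<rho>. levels \<rho> q gs))) Y
    \<le> (1 / r) ^ (b + 2 * b * j) * measure (measure_pmf (bind_pmf (geo r B) (\<lambda>\<rho>. levels \<rho> q gs'))) Y"
proof -
  let ?F = "\<lambda>gs \<rho>. measure (measure_pmf (levels \<rho> q gs)) Y"
  have "geo_mean r B (?F gs) \<le> geo_mean r B (\<lambda>\<rho>. (1 / r) ^ (2 * b * j) * ?F gs' (\<rho> + b))"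
    using r_pos r_le_1 levels_private[OF assms(1,2)] by (intro geo_mean_mono) auto
  also have "\<dots> = (1 / r) ^ (2 * b * j) * geo_mean r B (\<lambda>\<rho>. ?F gs' (\<rho> + b))"
    by (rule geo_mean_scale)
  also have "\<dots> \<le> (1 / r) ^ (2 * b * j) * ((1 / r) ^ b * geo_mean r B (?F gs'))"
  proof -
    have sat: "?F gs' i = ?F gs' B" if "B \<le> i" for i
      using levels_saturated[OF assms(3), of i B q] assms(4) that by simp
    have "r ^ b * geo_mean r B (\<lambda>\<rho>. ?F gs' (\<rho> + b)) \<le> geo_mean r B (?F gs')"
      using r_pos by (intro geo_mean_shift[where F = "?F gs'"] r_le_1 sat) auto
    then have "geo_mean r B (\<lambda>\<rho>. ?F gs' (\<rho> + b)) \<le> (1 / r) ^ b * geo_mean r B (?F gs')"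
      using r_pos by (simp add: field_simps)
    then show ?thesis
      using r_pos by (intro mult_left_mono) auto
  qed
  finally show ?thesis
    using r_pos r_le_1 by (simp add: measure_bind_geo power_add mult_ac)
qed

primrec slow_growth :: "nat \<Rightarrow> nat list \<Rightarrow> bool" where
  "slow_growth g [] \<longleftrightarrow> True"
| "slow_growth g (g' # gs) \<longleftrightarrow> g \<le> g' \<and> g' \<le> g + 1 \<and> g' \<le> n \<and> slow_growth g' gs"

section \<open>Accuracy of the level process\<close>

text \<open>The invariant is \<open>g \<le> q\<close> with \<open>2 * q \<le> 3 * (g + e)\<close>,
  where \<open>e\<close> is what the slack \<open>2 * D\<close> amounts to in unscaled counts. As
  counts grow by at most one, \<open>g' \<le> q + 1 \<le> next_level q\<close>, so one raise per
  step is enough. Only a wrong raise can break the invariant, at a cost of \<open>r ^ D\<close> per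
  step.\<close>

lemma levels_accurate:
  fixes e :: real
  assumes "\<rho> < D" and e: "\<And>x y. b * x < b * y + 2 * D \<Longrightarrow> real x \<le> real y + e"
    and "slow_growth g gs" and "g \<le> q" and "2 * real q \<le> 3 * (real g + e)"
  shows "1 - real (length gs) * r ^ D \<le> measure (measure_pmf (levels \<rho> q gs))
    {ys. list_all2 (\<lambda>g y. 2 * g \<le> y \<and> real y \<le> 3 * (real g + e)) gs ys}"
  using assms(3-)
proof (induction gs arbitrary: g q)
  case Nil
  then show ?case by simp
next
  case (Cons g' gs)
  let ?P = "\<lambda>g y. 2 * g \<le> y \<and> real y \<le> 3 * (real g + e)"
  let ?M = "\<lambda>q. measure (measure_pmf (levels \<rho> q gs)) {ys. ?P g' (2 * q) \<and> list_all2 ?P gs ys}"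
  let ?v = "1 - real (length gs) * r ^ D"
  have ge: "?v \<le> ?M q'" if "g' \<le> q'" "2 * real q' \<le> 3 * (real g' + e)" for q'
    using Cons.IH[of g' q'] Cons.prems(1) that by simp
  have stay: "2 * real q \<le> 3 * (real g' + e)"
    using Cons.prems by auto
  show ?case
  proof (cases "n \<le> q")
    case True
    have "?v \<le> ?M q" using ge stay Cons.prems True by auto
    moreover have "0 \<le> r ^ D" using r_pos by simp
    ultimately show ?thesis
      using True by (simp add: step_def bind_return_pmf vimage_def algebra_simps)
  next
    case False
    then have q: "q < n" by simp
    let ?e = "expo \<rho> q g'"
    have "?v - r ^ D \<le> r ^ ?e * ?M (next_level q) + (1 - r ^ ?e) * ?M q"
    proof -
      have gn: "g' \<le> next_level q" using Cons.prems by (auto simp: next_level_def)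
      have mn: "?M q \<ge> 0" "?M (next_level q) \<ge> 0" "?M q \<le> 1" by auto
      \<comment> \<open>A positive exponent means that the noisy threshold exceeds
        \<open>b * g' + D\<close>; with noise below \<open>D\<close> this shows that the present
        level still covers the count.\<close>
      have notc: "?v \<le> ?M q" if "?e > 0"
      proof (rule ge[OF _ stay])
        have "b * g' + D < b * (q + 1) + \<rho>" using that by (auto simp: expo_def)
        then have "b * g' < b * (q + 1)" using assms(1) by linarith
        then show "g' \<le> q" by (metis mult_less_cancel1 less_Suc_eq_le Suc_eq_plus1)
      qed
      \<comment> \<open>An exponent below \<open>D\<close> means that the threshold is below
        \<open>b * g' + 2 * D\<close>, so \<open>q + 1\<close> is small enough for a raise to
        respect the upper bound.\<close>
      have cr: "?v \<le> ?M (next_level q)" if "?e < D"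
      proof (rule ge[OF gn])
        have "b * (q + 1) < b * g' + 2 * D" using that by (auto simp: expo_def)
        from e[OF this] have "3 * real (q + 1) \<le> 3 * (real g' + e)" by simp
        moreover have "2 * next_level q \<le> 3 * (q + 1)" by (simp add: next_level_def)
        ultimately show "2 * real (next_level q) \<le> 3 * (real g' + e)" by linarith
      qed
      have "?e \<le> D" by (simp add: expo_def)
      then consider "?e = 0" | "0 < ?e" "?e < D" | "?e = D" by linarith
      then show ?thesis
      proof cases
        case 1
        then show ?thesis using cr D_pos power_r[of D] by simp
      next
        case 2
        have "r ^ ?e * ?v + (1 - r ^ ?e) * ?v \<le> r ^ ?e * ?M (next_level q) + (1 - r ^ ?e) * ?M q"
          using 2 power_r[of ?e] notc cr by (intro add_mono mult_left_mono) auto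
        then show ?thesis using power_r[of D] by (simp add: algebra_simps)
      next
        \<comment> \<open>Here a raise may be wrong, and its probability \<open>r ^ D\<close> is
          given up.\<close>
        case 3
        have "r ^ D * ?M q \<le> r ^ D * 1" using power_r[of D] mn by (intro mult_left_mono) auto
        moreover have "0 \<le> r ^ D * ?M (next_level q)" using power_r[of D] mn by auto
        ultimately show ?thesis
          using notc D_pos 3 unfolding 3 by (simp add: left_diff_distrib)
      qed
    qed
    then show ?thesis
      by (simp del: levels.simps add: measure_levels_Cons[OF q] algebra_simps)
  qed
qed

text \<open>The additional 1 in the failure bound is for the event that the noise reaches
  \<open>D\<close>; \<open>D \<le> B\<close> keeps the cap from changing its probability.\<close>

lemma noisy_levels_accurate:
  fixes e :: real
  assumes "\<And>x y. b * x < b * y + 2 * D \<Longrightarrow> real x \<le> real y + e"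
    and "slow_growth 0 gs" and "0 \<le> e" and "D \<le> B"
  shows "1 - real (length gs + 1) * r ^ D \<le>
    measure (measure_pmf (bind_pmf (geo r B) (\<lambda>\<rho>. levels \<rho> 0 gs)))
    {ys. list_all2 (\<lambda>g y. 2 * g \<le> y \<and> real y \<le> 3 * (real g + e)) gs ys}"
proof -
  have "(1 - r ^ D) * (1 - real (length gs) * r ^ D) \<le>
    geo_mean r B (\<lambda>\<rho>. measure (measure_pmf (levels \<rho> 0 gs))
      {ys. list_all2 (\<lambda>g y. 2 * g \<le> y \<and> real y \<le> 3 * (real g + e)) gs ys})"
    using r_pos r_le_1 assms by (intro geo_mean_ge levels_accurate) auto
  moreover have "1 - real (length gs + 1) * r ^ D \<le> (1 - r ^ D) * (1 - real (length gs) * r ^ D)"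
    using r_pos by (simp add: algebra_simps)
  ultimately show ?thesis
    using r_pos r_le_1 by (simp add: measure_bind_geo)
qed

end

section \<open>Greedy matchings\<close>

text \<open>Only the matched vertices are kept, at one bit each; half their number is the size of
  the matching.\<close>

definition absorb :: "nat set \<Rightarrow> update \<Rightarrow> nat set" where
  "absorb A u = (case u of None \<Rightarrow> A | Some e \<Rightarrow> if disjnt e A then A \<union> e else A)"

abbreviation greedy :: "nat set \<Rightarrow> update list \<Rightarrow> nat set" where
  "greedy \<equiv> foldl absorb"

primrec greedy_sizes :: "nat set \<Rightarrow> update list \<Rightarrow> nat list" where
  "greedy_sizes A [] = []"
| "greedy_sizes A (u # us) = card (absorb A u) div 2 # greedy_sizes (absorb A u) us"

lemma length_greedy_sizes [simp]: "length (greedy_sizes A us) = length us"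
  by (induction us arbitrary: A) auto

lemma nth_greedy_sizes:
  "i < length us \<Longrightarrow> greedy_sizes A us ! i = card (greedy A (take (Suc i) us)) div 2"
  by (induction us arbitrary: A i) (auto simp: nth_Cons' less_Suc_eq_0_disj)

lemma is_edgeE:
  assumes "is_edge n e"
  obtains x y where "x < y" "y < n" "e = {x, y}"
proof -
  obtain x y where "e = {x, y}" "x \<noteq> y"
    using assms by (auto simp: is_edge_def card_2_iff)
  then show ?thesis
    using that[of x y] that[of y x] assms
    by (cases "x < y") (auto simp: is_edge_def insert_commute)
qed

definition edge_updates :: "nat \<Rightarrow> update list \<Rightarrow> bool" where
  "edge_updates n us \<longleftrightarrow> (\<forall>e. Some e \<in> set us \<longrightarrow> is_edge n e)"

lemma edge_updates_simps [simp]: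
  "edge_updates n []"
  "edge_updates n (None # us) \<longleftrightarrow> edge_updates n us"
  "edge_updates n (Some e # us) \<longleftrightarrow> is_edge n e \<and> edge_updates n us"
  by (auto simp: edge_updates_def)

lemma absorb_subset:
  assumes "A \<subseteq> {..<n}" and "edge_updates n [u]"
  shows "absorb A u \<subseteq> {..<n}"
  using assms by (cases u) (auto simp: absorb_def is_edge_def)

lemma card_absorb:
  assumes "A \<subseteq> {..<n}" and "edge_updates n [u]"
  shows "card (absorb A u) = card A \<or> card (absorb A u) = card A + 2"
proof -
  have "finite A" using assms(1) finite_subset by blast
  then show ?thesis
    using assms(2) by (cases u)
      (auto simp: absorb_def is_edge_def card_Un_disjnt disjnt_sym card_ge_0_finite)
qed

lemma (in sparse_vector) slow_growth_greedy_sizes: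
  assumes "A \<subseteq> {..<n}" and "edge_updates n us"
  shows "slow_growth (card A div 2) (greedy_sizes A us)"
  using assms
proof (induction us arbitrary: A)
  case (Cons u us)
  have u: "edge_updates n [u]" "edge_updates n us"
    using Cons.prems by (cases u; simp)+
  have sub: "absorb A u \<subseteq> {..<n}" using Cons.prems u by (intro absorb_subset)
  then have "card (absorb A u) \<le> n" using card_mono[of "{..<n}"] by fastforce
  then show ?case
    using Cons.IH[OF sub u(2)] card_absorb[OF Cons.prems(1) u(1)] by auto
qed simp

lemma greedy_sizes_le:
  assumes "A \<subseteq> {..<n}" and "edge_updates n us" and "g \<in> set (greedy_sizes A us)"
  shows "g \<le> n"
  using assms
proof (induction us arbitrary: A)
  case (Cons u us)
  have u: "edge_updates n [u]" "edge_updates n us"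
    using Cons.prems by (cases u; simp)+
  have sub: "absorb A u \<subseteq> {..<n}" using Cons.prems u by (intro absorb_subset)
  then have "card (absorb A u) \<le> n" using card_mono[of "{..<n}"] by fastforce
  then show ?case
    using Cons.IH[OF sub u(2)] Cons.prems(3) by auto
qed simp

section \<open>The greedy matching is a two-approximation\<close>

text \<open>Reconstructs a matching from its endpoints: an edge is accepted exactly when it avoids
  the union of the edges accepted before, that is, when it is disjoint from each of them.\<close>

lemma greedy_matching:
  assumes "edge_updates n us"
  shows "\<exists>M. is_matching {e. Some e \<in> set us} M \<and> finite M \<and> \<Union>M = greedy {} us \<and>
    card (greedy {} us) = 2 * card M"
  using assms
proof (induction us rule: rev_induct)
  case Nil
  show ?case by (rule exI[of _ "{}"]) (simp add: is_matching_def)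
next
  case (snoc u us)
  have "edge_updates n us" using snoc.prems by (auto simp: edge_updates_def)
  then obtain M where M: "M \<subseteq> {e. Some e \<in> set us}" "pairwise disjnt M" "finite M"
      "\<Union>M = greedy {} us" "card (greedy {} us) = 2 * card M"
    using snoc.IH by (auto simp: is_matching_def)
  have same: ?case if "absorb (greedy {} us) u = greedy {} us"
    using M that by (intro exI[of _ M]) (auto simp: is_matching_def)
  show ?case
  proof (cases u)
    case None
    then show ?thesis by (intro same) (simp add: absorb_def[of "greedy {} us"])
  next
    case (Some e)
    show ?thesis
    proof (cases "disjnt e (greedy {} us)")
      case True
      have e: "card e = 2" "finite e"
        using snoc.prems Some by (auto simp: edge_updates_def is_edge_def card_ge_0_finite)
      have fin: "finite (greedy {} us)"
        using M e \<open>edge_updates n us\<close> 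
        by (metis (no_types, lifting) CollectD card_ge_0_finite edge_updates_def finite_Union
            is_edge_def subsetD zero_less_numeral)
      have "e \<noteq> {}" using e(1) by auto
      then have "e \<notin> M" using True M(4) by (auto simp: disjnt_def)
      moreover have "pairwise disjnt (insert e M)"
        using M(2,4) True by (auto simp: pairwise_insert disjnt_def)
      moreover have "card (greedy {} us \<union> e) = 2 * card M + 2"
        using True M(5) e fin by (simp add: card_Un_disjnt disjnt_sym)
      moreover have "greedy {} (us @ [u]) = greedy {} us \<union> e"
        using True Some by (simp add: absorb_def[of "greedy {} us"])
      ultimately show ?thesis
        using M Some by (intro exI[of _ "insert e M"]) (auto simp: is_matching_def)
    next
      case False
      then show ?thesis using Some by (intro same) (simp add: absorb_def[of "greedy {} us"])
    qed
  qed
qed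

lemma greedy_increasing: "A \<subseteq> greedy A us"
  by (induction us arbitrary: A) (force simp: absorb_def split: option.split)+

text \<open>Maximality: an edge is rejected only if it has a matched end, and matched vertices stay
  matched.\<close>

lemma greedy_covers:
  assumes "Some e \<in> set us" and "e \<noteq> {}"
  shows "\<not> disjnt e (greedy A us)"
  using assms(1)
proof (induction us arbitrary: A)
  case (Cons u us)
  show ?case
  proof (cases "u = Some e")
    case True
    then have "\<not> disjnt e (absorb A u)" using assms(2) by (auto simp: absorb_def disjnt_def)
    then show ?thesis
      using greedy_increasing[of "absorb A u" us] by (auto simp: disjnt_def)
  qed (use Cons in auto)
qed simp

lemma greedy_two_approximation:
  assumes "edge_updates n us"
  defines "E \<equiv> {e. Some e \<in> set us}"
  shows "card (greedy {} us) div 2 \<le> max_matching_size E"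
    and "max_matching_size E \<le> 2 * (card (greedy {} us) div 2)"
proof -
  obtain M where M: "is_matching E M" "finite M" "\<Union>M = greedy {} us" "card (greedy {} us) = 2 * card M"
    using greedy_matching[OF assms(1)] unfolding E_def by blast
  have "E \<subseteq> Pow {..<n}" using assms(1) by (auto simp: edge_updates_def is_edge_def E_def)
  then have finE: "finite E" by (rule finite_subset) simp
  have ne: "e \<noteq> {}" "e \<subseteq> {..<n}" if "e \<in> E" for e
    using that assms(1) by (auto simp: edge_updates_def is_edge_def E_def)
  have "{card N | N. is_matching E N} \<subseteq> card ` Pow E" by (auto simp: is_matching_def)
  then have fin: "finite {card N | N. is_matching E N}"
    by (rule finite_subset) (use finE in simp)
  show "card (greedy {} us) div 2 \<le> max_matching_size E"
    unfolding max_matching_size_def using M fin by (intro Max_ge) auto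
  have "greedy {} us \<subseteq> {..<n}" using M(1,3) ne by (auto simp: is_matching_def)
  then have fing: "finite (greedy {} us)" by (rule finite_subset) simp
  have "card N \<le> card (greedy {} us)" if N: "is_matching E N" for N
  proof -
    \<comment> \<open>Each edge of \<open>N\<close> is sent to one of its matched ends. Edges of a
      matching are disjoint, so this map is injective and \<open>N\<close> has at most as many edges
      as there are matched vertices.\<close>
    have "\<exists>v. v \<in> e \<inter> greedy {} us" if "e \<in> N" for e
      using greedy_covers[of e us "{}"] N that ne(1)[of e]
      by (auto simp: is_matching_def E_def disjnt_def)
    then obtain f where f: "\<And>e. e \<in> N \<Longrightarrow> f e \<in> e \<inter> greedy {} us" by metis
    have "inj_on f N"
    proof (rule inj_onI)
      fix e e' assume "e \<in> N" "e' \<in> N" "f e = f e'"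
      then have "\<not> disjnt e e'" using f[of e] f[of e'] by (auto simp: disjnt_def)
      then show "e = e'" using N \<open>e \<in> N\<close> \<open>e' \<in> N\<close> by (auto simp: is_matching_def pairwise_def)
    qed
    then show ?thesis using f fing by (intro card_inj_on_le[of f]) auto
  qed
  then show "max_matching_size E \<le> 2 * (card (greedy {} us) div 2)"
    unfolding max_matching_size_def using M(1,4) fin by (subst Max_le_iff) auto
qed

section \<open>Sensitivity of the greedy matching to one vertex\<close>

text \<open>How the matched vertices \<open>A\<close> relate to those, \<open>A'\<close>, of the stream without the edges at \<open>v\<close>:
  apart from \<open>v\<close> only the other end \<open>x\<close> of the alternating path changes its status.\<close>

definition detoured :: "nat \<Rightarrow> nat set \<Rightarrow> nat set \<Rightarrow> bool" where
  "detoured v A A' \<longleftrightarrow> v \<notin> A' \<and> (A = A' \<or>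
     (\<exists>x. x \<noteq> v \<and> (x \<notin> A' \<and> A = A' \<union> {v, x} \<or> x \<in> A' \<and> A = insert v A' - {x})))"

definition strip :: "nat \<Rightarrow> update \<Rightarrow> update" where
  "strip v u = (if incident_update v u then None else u)"

text \<open>An edge at \<open>v\<close> may start the path. If its far end \<open>x\<close> is
  matched only in the full run, an edge from \<open>x\<close> to a free \<open>z\<close> is taken by
  the stripped run alone; if \<open>x\<close> is matched only in the stripped run, it is taken by
  the full run alone. Either way the far end moves to \<open>z\<close> and the two forms of
  \<open>detoured\<close> alternate. All other edges away from \<open>v\<close> are treated alike by
  both runs.\<close>

lemma detoured_absorb:
  assumes "detoured v A A'" and "edge_updates n [u]"
  shows "detoured v (absorb A u) (absorb A' (strip v u))"
proof (cases u)
  case None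
  then show ?thesis using assms by (simp add: strip_def absorb_def incident_update_def)
next
  case (Some e)
  then obtain x y where e: "e = {x, y}" "x \<noteq> y"
    using assms(2) by (auto elim: is_edgeE)
  show ?thesis
  proof (cases "v \<in> e")
    case True
    obtain z where z: "e = {v, z}" "z \<noteq> v" using e True by auto
    then show ?thesis
      using assms(1) Some by (auto simp: detoured_def strip_def absorb_def incident_update_def disjnt_def)
  next
    case False
    have strip: "strip v u = u" using Some False by (simp add: strip_def incident_update_def)
    from assms(1) have v: "v \<notin> A'" by (simp add: detoured_def)
    from assms(1) consider "A = A'"
      | w where "w \<noteq> v" "w \<notin> A'" "A = A' \<union> {v, w}"
      | w where "w \<noteq> v" "w \<in> A'" "A = insert v A' - {w}"
      by (auto simp: detoured_def)
    then show ?thesis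
    proof cases
      case 1
      then show ?thesis
        using v False Some unfolding strip by (auto simp: detoured_def absorb_def)
    next
      case 2
      show ?thesis
      proof (cases "w \<in> e \<and> disjnt e A'")
        case True
        obtain z where z: "e = {w, z}" "z \<noteq> w" using e True by auto
        have "absorb A u = A" using Some 2 True by (auto simp: absorb_def disjnt_def)
        moreover have "absorb A' u = A' \<union> {w, z}" using Some True z by (simp add: absorb_def)
        moreover have "z \<notin> A'" "z \<noteq> v" using z True False by (auto simp: disjnt_def)
        ultimately show ?thesis
          using 2 v z unfolding strip detoured_def by auto
      next
        case no: False
        then consider "w \<notin> e" "disjnt e A'" | "\<not> disjnt e A'" by auto
        then show ?thesis
        proof cases
          case 1
          then have "absorb A u = A \<union> e" "absorb A' u = A' \<union> e"
            using Some 2 False by (auto simp: absorb_def disjnt_def)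
          then show ?thesis using 1 2 v False unfolding strip detoured_def by auto
        next
          case b: 2
          then have "absorb A u = A" "absorb A' u = A'"
            using Some 2 by (auto simp: absorb_def disjnt_def)
          then show ?thesis using assms(1) strip by simp
        qed
      qed
    next
      case 3
      consider "disjnt e A'" | "\<not> disjnt e A" | "\<not> disjnt e A'" "disjnt e A" by auto
      then show ?thesis
      proof cases
        case a: 1
        then have "absorb A u = A \<union> e" "absorb A' u = A' \<union> e"
          using Some 3 False by (auto simp: absorb_def disjnt_def)
        moreover have "w \<notin> e" using a 3 by (auto simp: disjnt_def)
        ultimately show ?thesis using 3 v False unfolding strip detoured_def by auto
      next
        case b: 2
        then have "absorb A u = A" "absorb A' u = A'"
          using Some 3 False by (auto simp: absorb_def disjnt_def)
        then show ?thesis using assms(1) strip by simp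
      next
        case c: 3
        then have "w \<in> e" using 3 by (auto simp: disjnt_def)
        then obtain z where z: "e = {w, z}" "z \<noteq> w" using e by auto
        have "absorb A u = A \<union> {w, z}" "absorb A' u = A'"
          using Some c z by (auto simp: absorb_def)
        moreover have "z \<notin> A'" "z \<noteq> v" using c z 3 False by (auto simp: disjnt_def)
        ultimately show ?thesis
          using 3 v unfolding strip detoured_def by auto
      qed
    qed
  qed
qed

lemma card_detoured:
  assumes "detoured v A A'" and "finite A'"
  shows "card A div 2 = card A' div 2 \<or> card A div 2 = card A' div 2 + 1"
proof -
  from assms(1) have v: "v \<notin> A'" by (simp add: detoured_def)
  from assms(1) consider "A = A'"
    | w where "w \<noteq> v" "w \<notin> A'" "A = A' \<union> {v, w}"
    | w where "w \<noteq> v" "w \<in> A'" "A = insert v A' - {w}"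
    by (auto simp: detoured_def)
  then show ?thesis
    using v assms(2) by cases auto
qed

lemma greedy_sizes_strip:
  assumes "detoured v A A'" and "A' \<subseteq> {..<n}" and "edge_updates n us"
  shows "list_all2 (\<lambda>g g'. g = g' \<or> g = g' + 1) (greedy_sizes A us) (greedy_sizes A' (map (strip v) us))"
  using assms
proof (induction us arbitrary: A A')
  case (Cons u us)
  have u: "edge_updates n [u]" "edge_updates n us" "edge_updates n [strip v u]"
    using Cons.prems by (cases u; simp add: strip_def)+
  have det: "detoured v (absorb A u) (absorb A' (strip v u))"
    using Cons.prems(1) u(1) by (rule detoured_absorb)
  have sub: "absorb A' (strip v u) \<subseteq> {..<n}" using Cons.prems u by (intro absorb_subset)
  then have "finite (absorb A' (strip v u))" by (rule finite_subset) simp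
  then show ?case using card_detoured[OF det] Cons.IH[OF det sub u(2)] by simp
qed simp

text \<open>Both streams become equal when the edges at \<open>v\<close> are erased. Each size
  exceeds that of the erased stream by 0 or 1, so the two sizes differ by at most 1.\<close>

lemma greedy_sizes_sensitivity:
  assumes "node_neighboring n S S'" and "edge_updates n S" and "edge_updates n S'"
  shows "list_all2 (\<lambda>g g'. g \<le> g' + 1 \<and> g' \<le> g + 1) (greedy_sizes {} S) (greedy_sizes {} S')"
proof -
  obtain v where v: "\<forall>i<length S. S ! i \<noteq> S' ! i \<longrightarrow>
        (S ! i = None \<and> incident_update v (S' ! i)) \<or> (S' ! i = None \<and> incident_update v (S ! i))"
    and len: "length S = length S'"
    using assms(1) by (auto simp: node_neighboring_def)
  have "strip v (S ! i) = strip v (S' ! i)" if "i < length S" for i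
    using v[rule_format, OF that] by (cases "S ! i = S' ! i") (auto simp: strip_def)
  then have eq: "map (strip v) S = map (strip v) S'"
    using len by (intro nth_equalityI) auto
  have det: "detoured v {} {}" by (simp add: detoured_def)
  have "list_all2 (\<lambda>g g'. g = g' \<or> g = g' + 1) (greedy_sizes {} S) (greedy_sizes {} (map (strip v) S))"
    "list_all2 (\<lambda>g g'. g = g' \<or> g = g' + 1) (greedy_sizes {} S') (greedy_sizes {} (map (strip v) S))"
    using greedy_sizes_strip[OF det _ assms(2)] greedy_sizes_strip[OF det _ assms(3)] eq by auto
  then show ?thesis
    using len by (fastforce simp: list_all2_conv_all_nth)
qed

section \<open>The programs\<close>

notation Seq (infixr \<open>;;\<close> 60)

abbreviation mov :: "nat \<Rightarrow> operand \<Rightarrow> com" where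
  "mov d x \<equiv> Add d x (Imm 0)"

text \<open>Repeated addition takes time linear in the second factor, which is polynomial in
  \<open>n\<close> wherever \<open>mul\<close> is used.\<close>

definition mul :: "nat \<Rightarrow> operand \<Rightarrow> operand \<Rightarrow> com" where
  "mul d x y = mov 21 y ;; mov d (Imm 0) ;;
     While 21 (Add d (Cell d) x ;; Sub 21 (Cell 21) (Imm 1))"

text \<open>Cell 18 becomes zero with probability \<open>1 / k\<close>, where the power of two \<open>k\<close> is stored in cell 6.\<close>

definition flip :: com where
  "flip = Half 19 (Cell 6) ;; mov 18 (Imm 0) ;;
     While 19 (Coin 20 ;; If 20 (mov 18 (Imm 1)) Skip ;; Half 19 (Cell 19))"

text \<open>Cell 17 counts the trials before the first failure, but at most as many as cell 16 says.\<close>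

definition sample :: com where
  "sample = mov 17 (Imm 0) ;;
     While 16 (flip ;; If 18 (Add 17 (Cell 17) (Imm 1) ;; Sub 16 (Cell 16) (Imm 1)) (mov 16 (Imm 0)))"

section \<open>The memory invariant and its space\<close>

text \<open>\<open>T\<close> and \<open>a\<close> sit in cells that are never written and may exceed
  \<open>M\<close>, so they are charged separately. The cells from 24 on are flags at consecutive
  addresses, one per vertex, which keeps their charge at two bits each.\<close>

definition memory_ok :: "nat \<Rightarrow> nat \<Rightarrow> nat \<Rightarrow> nat \<Rightarrow> mem \<Rightarrow> bool" where
  "memory_ok n T a M m \<longleftrightarrow> m 1 = T \<and> m 2 = a \<and> (\<forall>j<24. j \<noteq> 1 \<longrightarrow> j \<noteq> 2 \<longrightarrow> m j \<le> M) \<and>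
     (\<forall>j\<ge>24. m j \<le> 1) \<and> (\<forall>j\<ge>24 + n. m j = 0)"

definition memory_bits :: "nat \<Rightarrow> nat \<Rightarrow> nat \<Rightarrow> nat \<Rightarrow> nat" where
  "memory_bits n T a M = 24 * (1 + floorlog 2 M) + floorlog 2 T + floorlog 2 a + 2 * n"

lemma memory_ok_bits:
  assumes "memory_ok n T a M m"
  shows "mem_bits m \<le> memory_bits n T a M"
proof -
  let ?f = "\<lambda>i. 1 + floorlog 2 (m i)"
  have "(LEAST L. \<forall>j\<ge>L. m j = 0) \<le> 24 + n"
    using assms by (intro Least_le) (auto simp: memory_ok_def)
  then have "mem_bits m \<le> (\<Sum>i<24 + n. ?f i)"
    unfolding mem_bits_def by (intro sum_mono2) auto
  also have "\<dots> = (\<Sum>i<24. ?f i) + (\<Sum>i\<in>{24..<24 + n}. ?f i)"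
    by (subst sum.union_disjoint[symmetric]) (auto intro: sum.cong)
  also have "(\<Sum>i\<in>{24..<24 + n}. ?f i) \<le> (\<Sum>i\<in>{24..<24 + n}. 2)"
  proof (rule sum_mono)
    fix i assume "i \<in> {24..<24 + n}"
    then have "m i \<le> 1" using assms by (auto simp: memory_ok_def)
    then have "floorlog 2 (m i) \<le> floorlog 2 1" by (rule floorlog_mono)
    then show "?f i \<le> 2" by (simp add: floorlog_def)
  qed
  also have "(\<Sum>i<24. ?f i) \<le>
      (\<Sum>i<24::nat. (1 + floorlog 2 M) + ((if i = 1 then floorlog 2 T else 0) + (if i = 2 then floorlog 2 a else 0)))"
  proof (rule sum_mono)
    fix i :: nat assume "i \<in> {..<24}"
    then have "i \<noteq> 1 \<Longrightarrow> i \<noteq> 2 \<Longrightarrow> floorlog 2 (m i) \<le> floorlog 2 M" "m 1 = T" "m 2 = a"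
      using assms by (auto simp: memory_ok_def intro!: floorlog_mono)
    then show "?f i \<le> (1 + floorlog 2 M) + ((if i = 1 then floorlog 2 T else 0) + (if i = 2 then floorlog 2 a else 0))"
      by (cases "i = 1"; cases "i = 2") auto
  qed
  also have "\<dots> = 24 * (1 + floorlog 2 M) + (floorlog 2 T + floorlog 2 a)"
    unfolding sum.distrib by (simp add: sum.delta)
  finally show ?thesis by (simp add: memory_bits_def)
qed

lemma memory_ok_upd [simp]:
  "memory_ok n T a M m \<Longrightarrow> j < 24 \<Longrightarrow> j \<noteq> 1 \<Longrightarrow> j \<noteq> 2 \<Longrightarrow> v \<le> M \<Longrightarrow> memory_ok n T a M (m(j := v))"
  by (auto simp: memory_ok_def)

lemma memory_ok_flag:
  "memory_ok n T a M m \<Longrightarrow> x < n \<Longrightarrow> memory_ok n T a M (m(x + 24 := 1))"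
  by (auto simp: memory_ok_def)

locale machine = 
  fixes n T a M :: nat
  assumes M_pos: "1 \<le> M"
begin

sublocale space_bound "memory_ok n T a M" "memory_bits n T a M"
  by unfold_locales (rule memory_ok_bits)

abbreviation ok :: "mem \<Rightarrow> bool" where
  "ok \<equiv> memory_ok n T a M"

lemma ok_le: "ok m \<Longrightarrow> j < 24 \<Longrightarrow> j \<noteq> 1 \<Longrightarrow> j \<noteq> 2 \<Longrightarrow> m j \<le> M"
  by (simp add: memory_ok_def)

section \<open>Multiplication, biased coins and sampling\<close>

text \<open>The operand \<open>x\<close> is read in every round, so it must be neither the
  accumulator nor the counter. Bounding the final value by \<open>M\<close> bounds all partial
  sums.\<close>

lemma sim_mul_loop:
  assumes "ok m" and "d < 24" "d \<noteq> 1" "d \<noteq> 2" "d \<noteq> 21" and "x \<noteq> Cell d" "x \<noteq> Cell 21"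
    and "m d + val m x * m 21 \<le> M"
  shows "sim (While 21 (Add d (Cell d) x ;; Sub 21 (Cell 21) (Imm 1))) m (3 * m 21 + 1) (return_pmf ())
    (\<lambda>m' _. m' d = m d + val m x * m 21 \<and> (\<forall>j. j \<noteq> d \<longrightarrow> j \<noteq> 21 \<longrightarrow> m' j = m j))"
  using assms(1,8)
proof (induction "m 21" arbitrary: m)
  case 0
  then show ?case by (intro sim_mono[OF sim_While_exit[where R = "\<lambda>m' _. m' = m"]]) auto
next
  case (Suc c)
  let ?m = "m(d := m d + val m x, 21 := c)"
  have v: "val ?m x = val m x" using assms(2-7) by (cases x) auto
  have c: "m d + val m x + val m x * c \<le> M" using Suc.prems(2) by (simp flip: Suc.hyps(2))
  have okd: "ok (m(d := m d + val m x))" using Suc.prems assms(2-4) c by (intro memory_ok_upd) auto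
  have "m 21 \<le> M" using Suc.prems(1) by (simp add: ok_le)
  then have ok: "ok ?m" by (intro memory_ok_upd[OF okd]) (use Suc.hyps(2) in auto)
  have "sim (While 21 (Add d (Cell d) x ;; Sub 21 (Cell 21) (Imm 1))) m
      (Suc (2 + (3 * c + 1))) (bind_pmf (return_pmf ()) (\<lambda>_. return_pmf ()))
    (\<lambda>m' _. m' d = m d + val m x * m 21 \<and> (\<forall>j. j \<noteq> d \<longrightarrow> j \<noteq> 21 \<longrightarrow> m' j = m j))"
  proof (rule sim_While_step[where R = "\<lambda>m' _. m' = ?m"])
    show "sim (Add d (Cell d) x ;; Sub 21 (Cell 21) (Imm 1)) m 2 (return_pmf ()) (\<lambda>m' _. m' = ?m)"
      unfolding numeral_2_eq_2
      by (rule sim_Seq_tick[OF _ Suc.prems(1) okd], simp, rule sim_tick[where m' = ?m])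
         (use okd ok assms(2-7) in \<open>auto simp flip: Suc.hyps(2)\<close>)
    show "sim (While 21 (Add d (Cell d) x ;; Sub 21 (Cell 21) (Imm 1))) m' (3 * c + 1) (return_pmf ())
      (\<lambda>m' _. m' d = m d + val m x * m 21 \<and> (\<forall>j. j \<noteq> d \<longrightarrow> j \<noteq> 21 \<longrightarrow> m' j = m j))"
      if "m' = ?m" for m'
      unfolding that
      by (rule sim_mono[OF Suc.hyps(1)[of ?m]])
         (use c ok v assms(5) Suc.hyps(2) in \<open>auto simp flip: Suc.hyps(2)\<close>)
  qed (use Suc in auto)
  then show ?case unfolding bind_return_pmf by (rule sim_mono) (auto simp flip: Suc.hyps(2))
qed

lemma sim_mul:
  assumes "ok m" and "d < 24" "d \<noteq> 1" "d \<noteq> 2" "d \<noteq> 21" and "x \<noteq> Cell d" "x \<noteq> Cell 21"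
    and "val m x * val m y \<le> M" and "val m y \<le> M"
  shows "sim (mul d x y) m (3 * val m y + 3) (return_pmf ())
    (\<lambda>m' _. m' d = val m x * val m y \<and> (\<forall>j. j \<noteq> d \<longrightarrow> j \<noteq> 21 \<longrightarrow> m' j = m j))"
proof -
  let ?m1 = "m(21 := val m y)" and ?m2 = "m(21 := val m y, d := 0)"
  have v: "val ?m2 x = val m x" using assms(2-7) by (cases x) auto
  have ok: "ok ?m1" "ok ?m2" using assms by (auto intro!: memory_ok_upd)
  have "sim (While 21 (Add d (Cell d) x ;; Sub 21 (Cell 21) (Imm 1))) ?m2 (3 * val m y + 1) (return_pmf ())
    (\<lambda>m' _. m' d = val m x * val m y \<and> (\<forall>j. j \<noteq> d \<longrightarrow> j \<noteq> 21 \<longrightarrow> m' j = m j))"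
    by (rule sim_mono[OF sim_mul_loop]) (use assms ok v in auto)
  then have "sim (mul d x y) m (Suc (Suc (3 * val m y + 1))) (return_pmf ())
    (\<lambda>m' _. m' d = val m x * val m y \<and> (\<forall>j. j \<noteq> d \<longrightarrow> j \<noteq> 21 \<longrightarrow> m' j = m j))"
    unfolding mul_def using ok assms(1)
    by (intro sim_Seq_tick[where m' = ?m1] sim_Seq_tick[where m' = ?m2]) auto
  then show ?thesis by (rule sim_mono) auto
qed

text \<open>Cell 19 passes through \<open>2 ^ j div 2\<close>, ..., 1, 0, so exactly
  \<open>j\<close> coins are tossed, and cell 18 records whether any of them showed 1. For
  \<open>j = 0\<close> the initial value \<open>1 div 2\<close> is already 0.\<close>

lemma sim_flip_loop:
  assumes "ok m" and "m 19 = 2 ^ j div 2"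
  shows "sim (While 19 (Coin 20 ;; If 20 (mov 18 (Imm 1)) Skip ;; Half 19 (Cell 19))) m (6 * j + 1)
    (bernoulli_pmf (1 - (1/2) ^ j))
    (\<lambda>m' y. (m' 18 \<noteq> 0 \<longleftrightarrow> m 18 \<noteq> 0 \<or> y) \<and> (\<forall>j. j \<notin> {18, 19, 20} \<longrightarrow> m' j = m j))"
  using assms
proof (induction j arbitrary: m)
  case 0
  have "bernoulli_pmf 0 = return_pmf False"
    by (rule pmf_eqI) (case_tac i; simp)
  then show ?case
    using 0 by (auto intro!: sim_mono[OF sim_While_exit[where R = "\<lambda>m' y. m' = m \<and> \<not> y"]])
next
  case (Suc j)
  let ?c = "If 20 (mov 18 (Imm 1)) Skip ;; Half 19 (Cell 19)"
  let ?R = "\<lambda>m' s. (m' 18 \<noteq> 0 \<longleftrightarrow> m 18 \<noteq> 0 \<or> s) \<and> m' 19 = 2 ^ j div 2 \<and>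
     (\<forall>j. j \<notin> {18, 19, 20} \<longrightarrow> m' j = m j)"
  have m19: "m 19 = 2 ^ j" using Suc.prems(2) by simp
  have le: "2 ^ j \<le> M" using ok_le[OF Suc.prems(1), of 19] m19 by simp
  then have le': "2 ^ j div 2 \<le> M" by linarith
  have okc: "ok (m(20 := 0))" "ok (m(20 := 1))" using Suc.prems(1) M_pos by auto
  have body: "sim (Coin 20 ;; ?c) m (Suc 0 + 4) (bind_pmf (bernoulli_pmf (1/2)) return_pmf) ?R"
  proof (rule sim_Seq[OF sim_Coin[where R = "\<lambda>m' s. m' = m(20 := of_bool s)"]])
    fix m' s
    assume "m' = m(20 := of_bool s)" and "ok m'"
    then have m': "m' 20 = of_bool s" "m' 18 = m 18" "m' 19 = 2 ^ j" "\<And>j. j \<noteq> 20 \<Longrightarrow> m' j = m j"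
      by (auto simp: m19)
    let ?R' = "\<lambda>m' s. (m' 18 \<noteq> 0 \<longleftrightarrow> m 18 \<noteq> 0 \<or> s) \<and> m' 19 = 2 ^ j \<and>
     (\<forall>j. j \<notin> {18, 20} \<longrightarrow> m' j = m j)"
    have 1: "sim (If 20 (mov 18 (Imm 1)) Skip) m' (Suc (Suc 0 + Suc 0)) (return_pmf ()) (\<lambda>m' _. ?R' m' s)"
    proof (rule sim_If[OF \<open>ok m'\<close>])
      show "sim (mov 18 (Imm 1)) m' (Suc 0) (return_pmf ()) (\<lambda>m' _. ?R' m' s)" if "m' 20 \<noteq> 0"
        by (rule sim_tick[where m' = "m'(18 := 1)"])
           (use that m' \<open>ok m'\<close> M_pos in \<open>auto simp: m19\<close>)
      show "sim Skip m' (Suc 0) (return_pmf ()) (\<lambda>m' _. ?R' m' s)" if "m' 20 = 0"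
        by (rule sim_tick[where m' = "m'"])
           (use that m' \<open>ok m'\<close> M_pos in \<open>auto simp: m19\<close>)
    qed
    have "sim ?c m' (Suc (Suc 0 + Suc 0) + Suc 0) (return_pmf s) ?R"
    proof (rule sim_Seq_det[OF 1])
      fix m''
      assume "ok m''" and "?R' m'' s"
      then show "sim (Half 19 (Cell 19)) m'' (Suc 0) (return_pmf s) ?R"
        using le' by (intro sim_tick[where m' = "m''(19 := m'' 19 div 2)"]) auto
    qed
    then show "sim ?c m' 4 (return_pmf s) ?R" by (rule sim_mono) auto
  qed (use Suc.prems(1) okc in auto)
  let ?R = "\<lambda>m' y. (m' 18 \<noteq> 0 \<longleftrightarrow> m 18 \<noteq> 0 \<or> y) \<and> (\<forall>j. j \<notin> {18, 19, 20} \<longrightarrow> m' j = m j)"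
  have "sim (While 19 (Coin 20 ;; ?c)) m (Suc ((Suc 0 + 4) + (6 * j + 1)))
     (bind_pmf (bind_pmf (bernoulli_pmf (1/2)) return_pmf)
        (\<lambda>s. map_pmf (\<lambda>y. s \<or> y) (bernoulli_pmf (1 - (1/2) ^ j)))) ?R"
  proof (rule sim_While_step[OF Suc.prems(1) _ body])
    show "m 19 \<noteq> 0" using m19 by simp
    fix m' s
    assume "ok m'" and m': "(m' 18 \<noteq> 0 \<longleftrightarrow> m 18 \<noteq> 0 \<or> s) \<and> m' 19 = 2 ^ j div 2 \<and>
      (\<forall>j. j \<notin> {18, 19, 20} \<longrightarrow> m' j = m j)"
    show "sim (While 19 (Coin 20 ;; ?c)) m' (6 * j + 1)
       (map_pmf (\<lambda>y. s \<or> y) (bernoulli_pmf (1 - (1/2) ^ j))) ?R"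
      by (rule sim_map, rule sim_mono[OF Suc.IH[OF \<open>ok m'\<close>]]) (use m' in auto)
  qed
  moreover have "bind_pmf (bind_pmf (bernoulli_pmf (1/2)) return_pmf)
        (\<lambda>s. map_pmf (\<lambda>y. s \<or> y) (bernoulli_pmf (1 - (1/2) ^ j))) = bernoulli_pmf (1 - (1/2) ^ Suc j)"
    using bind_bernoulli_disj[of "(1/2) ^ j"] by (simp add: bind_return_pmf' power_le_one mult.commute)
  ultimately show ?case by (simp add: algebra_simps)
qed

lemma sim_flip:
  assumes "ok m" and "m 6 = 2 ^ \<kappa>"
  shows "sim flip m (6 * \<kappa> + 3) (bernoulli_pmf (1 - (1/2) ^ \<kappa>))
    (\<lambda>m' y. (m' 18 \<noteq> 0 \<longleftrightarrow> y) \<and> (\<forall>j. j \<notin> {18, 19, 20} \<longrightarrow> m' j = m j))"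
proof -
  have "2 ^ \<kappa> \<le> M" using ok_le[OF assms(1), of 6] assms(2) by simp
  then have "2 ^ \<kappa> div 2 \<le> M" by linarith
  then have ok: "ok (m(19 := 2 ^ \<kappa> div 2))" "ok (m(19 := 2 ^ \<kappa> div 2, 18 := 0))"
    using assms(1) by auto
  have "sim flip m (Suc (Suc (6 * \<kappa> + 1))) (bernoulli_pmf (1 - (1/2) ^ \<kappa>))
    (\<lambda>m' y. (m' 18 \<noteq> 0 \<longleftrightarrow> y) \<and> (\<forall>j. j \<notin> {18, 19, 20} \<longrightarrow> m' j = m j))"
    unfolding flip_def
    apply (rule sim_Seq_tick[OF _ assms(1) ok(1)])
     apply (simp add: assms)
    apply (rule sim_Seq_tick[OF _ ok])
     apply simp
    apply (rule sim_mono[OF sim_flip_loop[OF ok(2)]])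
      apply auto
    done
  then show ?thesis by (rule sim_mono) auto
qed

text \<open>Cell 16 holds the number of trials left and is set to 0 by a failure, so both ways of
  stopping meet the same loop test and the loop follows the recursion of \<open>geo\<close>.\<close>

lemma sim_sample_loop:
  assumes "ok m" and "m 6 = 2 ^ \<kappa>" and "m 17 + m 16 \<le> M"
  shows "sim (While 16 (flip ;; If 18 (Add 17 (Cell 17) (Imm 1) ;; Sub 16 (Cell 16) (Imm 1)) (mov 16 (Imm 0))))
    m ((6 * \<kappa> + 8) * m 16 + 1) (geo (1 - (1/2) ^ \<kappa>) (m 16))
    (\<lambda>m' y. m' 17 = m 17 + y \<and> y \<le> m 16 \<and> (\<forall>j. j \<notin> {16, 17, 18, 19, 20} \<longrightarrow> m' j = m j))"
  using assms
proof (induction "m 16" arbitrary: m)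
  case 0
  have "sim (While 16 c) m (Suc 0) (return_pmf 0) (\<lambda>m' y. m' = m \<and> y = 0)" for c
    using 0 by (intro sim_While_exit) auto
  then show ?case unfolding 0(1)[symmetric] geo.simps by (rule sim_mono) auto
next
  case (Suc N)
  let ?b = "If 18 (Add 17 (Cell 17) (Imm 1) ;; Sub 16 (Cell 16) (Imm 1)) (mov 16 (Imm 0))"
  let ?R = "\<lambda>m' s. m' 16 = (if s then N else 0) \<and> m' 17 = m 17 + of_bool s \<and>
    (\<forall>j. j \<notin> {16, 17, 18, 19, 20} \<longrightarrow> m' j = m j)"
  let ?B = "bernoulli_pmf (1 - (1/2) ^ \<kappa>)"
  have body: "sim (flip ;; ?b) m ((6 * \<kappa> + 3) + 4) (bind_pmf ?B return_pmf) ?R"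
  proof (rule sim_Seq[OF sim_flip[OF Suc.prems(1,2)]])
    fix m' s
    assume ok: "ok m'" and m': "(m' 18 \<noteq> 0 \<longleftrightarrow> s) \<and> (\<forall>j. j \<notin> {18, 19, 20} \<longrightarrow> m' j = m j)"
    then have c: "m' 16 = Suc N" "m' 17 = m 17" "m 17 + Suc N \<le> M" using Suc by auto
    have "sim ?b m' (Suc (Suc (Suc 0) + Suc 0)) (return_pmf s) ?R"
    proof (rule sim_If[OF ok])
      assume "m' 18 \<noteq> 0"
      then have s: s using m' by simp
      have ok1: "ok (m'(17 := m' 17 + 1))" and ok2: "ok (m'(17 := m' 17 + 1, 16 := N))"
        using ok c by auto
      show "sim (Add 17 (Cell 17) (Imm 1) ;; Sub 16 (Cell 16) (Imm 1)) m' (Suc (Suc 0)) (return_pmf s) ?R"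
        by (rule sim_Seq_tick[OF _ ok ok1], simp, rule sim_tick[OF _ ok1 ok2]) (use c m' s in auto)
    next
      assume "m' 18 = 0"
      then have s: "\<not> s" using m' by simp
      have ok1: "ok (m'(16 := 0))" using ok by auto
      show "sim (mov 16 (Imm 0)) m' (Suc 0) (return_pmf s) ?R"
        by (rule sim_tick[OF _ ok ok1]) (use c m' s in auto)
    qed
    then show "sim ?b m' 4 (return_pmf s) ?R" by (rule sim_mono) auto
  qed
  let ?R' = "\<lambda>m' y. m' 17 = m 17 + y \<and> y \<le> Suc N \<and> (\<forall>j. j \<notin> {16, 17, 18, 19, 20} \<longrightarrow> m' j = m j)"
  have "sim (While 16 (flip ;; ?b)) m (Suc ((6 * \<kappa> + 3 + 4) + ((6 * \<kappa> + 8) * N + 1)))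
    (bind_pmf (bind_pmf ?B return_pmf)
       (\<lambda>s. if s then map_pmf Suc (geo (1 - (1/2) ^ \<kappa>) N) else return_pmf 0)) ?R'"
  proof (rule sim_While_step[OF Suc.prems(1) _ body])
    show "m 16 \<noteq> 0" using Suc.hyps(2) by simp
    fix m' s
    assume ok: "ok m'" and m': "?R m' s"
    show "sim (While 16 (flip ;; ?b)) m' ((6 * \<kappa> + 8) * N + 1)
      (if s then map_pmf Suc (geo (1 - (1/2) ^ \<kappa>) N) else return_pmf 0) ?R'"
    proof (cases s)
      case True
      have N: "N = m' 16" using m' True by simp
      have "sim (While 16 (flip ;; ?b)) m' ((6 * \<kappa> + 8) * m' 16 + 1) (geo (1 - (1/2) ^ \<kappa>) (m' 16))
          (\<lambda>m'' y. m'' 17 = m' 17 + y \<and> y \<le> m' 16 \<and> (\<forall>j. j \<notin> {16, 17, 18, 19, 20} \<longrightarrow> m'' j = m' j))"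
        by (rule Suc.hyps(1)[OF N ok]) (use m' Suc True in auto)
      then show ?thesis
        unfolding N[symmetric] using True m' by (auto intro!: sim_map elim!: sim_mono)
    next
      case False
      then have "sim (While 16 (flip ;; ?b)) m' (Suc 0) (return_pmf 0) ?R'"
        using m' ok by (intro sim_While_exit) auto
      then show ?thesis using False by (auto elim!: sim_mono)
    qed
  qed
  then show ?case
    unfolding Suc.hyps(2)[symmetric] bind_return_pmf' geo.simps by (rule sim_mono) auto
qed

lemma sim_sample:
  assumes "ok m" and "m 6 = 2 ^ \<kappa>"
  shows "sim sample m ((6 * \<kappa> + 8) * m 16 + 2) (geo (1 - (1/2) ^ \<kappa>) (m 16))
    (\<lambda>m' y. m' 17 = y \<and> y \<le> m 16 \<and> (\<forall>j. j \<notin> {16, 17, 18, 19, 20} \<longrightarrow> m' j = m j))"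
proof -
  have ok: "ok (m(17 := 0))" using assms(1) by auto
  have "m 16 \<le> M" using ok_le[OF assms(1), of 16] by simp
  then have "sim sample m (Suc ((6 * \<kappa> + 8) * m 16 + 1)) (geo (1 - (1/2) ^ \<kappa>) (m 16))
    (\<lambda>m' y. m' 17 = y \<and> y \<le> m 16 \<and> (\<forall>j. j \<notin> {16, 17, 18, 19, 20} \<longrightarrow> m' j = m j))"
    unfolding sample_def
    using sim_sample_loop[OF ok, of \<kappa>] assms
    by (intro sim_Seq_tick[OF _ assms(1) ok]) (auto elim!: sim_mono)
  then show ?thesis by (rule sim_mono) auto
qed

end

text \<open>
  Cells 6 to 12 hold \<open>k\<close>, \<open>D\<close>, \<open>2 D\<close>, \<open>b\<close>, the noise, \<open>b\<close> times the size of the greedy matching, and the current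
  level \<open>q\<close>; cell \<open>v + 24\<close> tells whether the vertex \<open>v\<close> is matched. The other cells below 24 are scratch space.
  If \<open>w \<ge> n\<close>, then the additive error may be as large as \<open>2 n\<close> and the level is \<open>n\<close> from the beginning. Taking
  minima with \<open>n\<close> and \<open>2 D\<close> keeps time and space independent of \<open>\<epsilon>\<close>.
\<close>

definition preprocess :: "nat \<Rightarrow> nat \<Rightarrow> nat \<Rightarrow> com" where
  "preprocess \<mu> w b\<^sub>0 =
     mov 13 (Cell 0) ;;
     While 13 (Half 13 (Cell 13) ;; Add 14 (Cell 14) (Imm 1)) ;;
     Sub 13 (Cell 0) (Imm w) ;; Sub 22 (Cell 0) (Cell 13) ;;
     If 13 Skip (mov 12 (Cell 0)) ;;
     mul 15 (Cell 22) (Cell 14) ;;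
     mov 6 (Imm 2) ;; Sub 13 (Cell 15) (Cell 6) ;;
     While 13 (Add 6 (Cell 6) (Cell 6) ;; Sub 13 (Cell 15) (Cell 6)) ;;
     mul 15 (Imm \<mu>) (Cell 14) ;; mul 7 (Cell 6) (Cell 15) ;;
     Add 8 (Cell 7) (Cell 7) ;;
     Sub 13 (Cell 8) (Imm b\<^sub>0) ;; Sub 9 (Cell 8) (Cell 13) ;;
     Add 13 (Cell 0) (Imm 1) ;; mul 16 (Cell 8) (Cell 13) ;;
     sample ;; mov 10 (Cell 17)"

text \<open>The difference of the two ends is positive for an edge and 0 for the empty update. The
  sum of the two flags is 0 exactly when both ends are free. Cell 11 grows by \<open>b\<close> per
  matched edge, so the scaled size needs no multiplication.\<close>

definition match_edge :: com where
  "match_edge =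
     Sub 13 (Cell 4) (Cell 3) ;;
     If 13
       (Add 13 (Cell 3) (Imm 24) ;; Add 14 (Cell 4) (Imm 24) ;;
        Load 15 (Cell 13) ;; Load 16 (Cell 14) ;; Add 15 (Cell 15) (Cell 16) ;;
        If 15 Skip
          (Store (Cell 13) (Imm 1) ;; Store (Cell 14) (Imm 1) ;; Add 11 (Cell 11) (Cell 9)))
       Skip"

text \<open>Cell 22 receives \<open>expo\<close>. A sample with this cap reaches it with probability
  \<open>r ^ expo\<close>, and only then is cell 13 zero at the last test and the level
  raised.\<close>

definition raise_level :: com where
  "raise_level =
     Sub 13 (Cell 0) (Cell 12) ;;
     If 13
       (Add 14 (Cell 12) (Imm 1) ;; mul 15 (Cell 9) (Cell 14) ;; Add 15 (Cell 15) (Cell 10) ;;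
        Add 22 (Cell 11) (Cell 8) ;; Sub 22 (Cell 22) (Cell 15) ;; Sub 22 (Cell 7) (Cell 22) ;;
        mov 16 (Cell 22) ;; sample ;; Sub 13 (Cell 22) (Cell 17) ;;
        If 13 Skip (Half 13 (Cell 14) ;; Add 12 (Cell 14) (Cell 13)))
       Skip"

definition update_program :: com where
  "update_program = match_edge ;; raise_level ;; Add 5 (Cell 12) (Cell 12)"

text \<open>
  The theorem takes \<open>w = \<lceil>10/\<epsilon>\<rceil>\<close> and \<open>b\<^sub>0 = max 1 \<lfloor>\<epsilon>/10\<rfloor>\<close>, so that \<open>w / b\<^sub>0\<close> is of order \<open>1/\<epsilon>\<close> for small and for large \<open>\<epsilon>\<close>,
  and \<open>\<mu> \<ge> c + 2\<close>, so that \<open>r ^ D \<le> n powr - \<mu>\<close> is small compared with \<open>1 / T\<close>. The total privacy loss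
  is about \<open>10 b len / k\<close>. \<open>M\<close> bounds all numbers that are computed.
\<close>

locale algorithm =
  fixes n T a \<mu> w b\<^sub>0 :: nat
  assumes n_pos: "1 \<le> n" and mu_pos: "1 \<le> \<mu>" and w_pos: "1 \<le> w" and b0_pos: "1 \<le> b\<^sub>0"
begin

section \<open>The parameters and their sizes\<close>

definition len :: nat where "len = floorlog 2 n"
text \<open>Leastness keeps \<open>k\<close> within a factor 2 of \<open>min n w * len\<close>;
  \<open>1 \<le> i\<close> makes \<open>k\<close> at least 2 and hence \<open>r\<close> at least
  1/2.\<close>

definition \<kappa> :: nat where "\<kappa> = (LEAST i. 1 \<le> i \<and> min n w * len \<le> 2 ^ i)"
definition k :: nat where "k = 2 ^ \<kappa>"
text \<open>The quotient \<open>D / k = \<mu> * len\<close> makes \<open>r ^ D\<close> polynomially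
  small in \<open>n\<close>.\<close>

definition D :: nat where "D = k * (\<mu> * len)"
definition b :: nat where "b = min (2 * D) b\<^sub>0"
text \<open>Since \<open>b \<le> 2 * D\<close>, this is at least \<open>2 * D + b * n\<close>,
  beyond which the noise no longer influences the levels.\<close>

definition B :: nat where "B = 2 * D * (n + 1)"
definition M :: nat where "M = 30 * \<mu> * n ^ 4"
definition r :: real where "r = 1 - (1/2) ^ \<kappa>"

lemma len_pos: "1 \<le> len" and len_le: "len \<le> n" and n_less: "n < 2 ^ len"
proof -
  show "1 \<le> len" using n_pos unfolding len_def by (subst compute_floorlog) auto
  show "len \<le> n" unfolding len_def by (rule floorlog_leI) auto
  show "n < 2 ^ len" using floorlog_bounds[of n 2] n_pos by (simp add: len_def)
qed

lemma kappa: "1 \<le> \<kappa>" "min n w * len \<le> k" "k \<le> 2 * (min n w * len)"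
proof -
  have "1 \<le> min n w * len \<and> min n w * len \<le> 2 ^ (min n w * len)"
    using n_pos w_pos len_pos by auto
  then have "1 \<le> \<kappa> \<and> min n w * len \<le> 2 ^ \<kappa>"
    unfolding \<kappa>_def by (intro LeastI[where P = "\<lambda>i. 1 \<le> i \<and> min n w * len \<le> 2 ^ i"])
  then show 1: "1 \<le> \<kappa>" "min n w * len \<le> k" by (auto simp: k_def)
  show "k \<le> 2 * (min n w * len)"
  proof (cases "\<kappa> = 1")
    case True
    then show ?thesis using n_pos w_pos len_pos by (auto simp: k_def)
  next
    case False
    then obtain i where i: "\<kappa> = Suc i" "1 \<le> i" using 1 by (cases \<kappa>) auto
    then have "\<not> (1 \<le> i \<and> min n w * len \<le> 2 ^ i)"
      unfolding \<kappa>_def by (intro not_less_Least) simp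
    then show ?thesis using i by (simp add: k_def)
  qed
qed

lemma k_ge: "2 \<le> k"
  using kappa(1) power_increasing[of 1 \<kappa> "2::nat"] by (simp add: k_def)

lemma D_pos: "1 \<le> D"
  using k_ge mu_pos len_pos by (simp add: D_def Suc_le_eq)

lemma b_le: "b \<le> 2 * D"
  by (simp add: b_def)

lemma r_bounds: "0 < r" "r \<le> 1"
proof -
  have "(1/2 :: real) ^ \<kappa> \<le> (1/2) ^ 1" using kappa(1) by (intro power_decreasing) auto
  then show "0 < r" by (simp add: r_def)
qed (simp add: r_def)

sublocale sparse_vector n b D r
  using r_bounds D_pos by unfold_locales auto

text \<open>\<open>k\<close> is at most \<open>2 * n ^ 2\<close>, \<open>D\<close> at most
  \<open>2 * \<mu> * n ^ 3\<close> and \<open>B\<close> at most \<open>8 * \<mu> * n ^ 4\<close>.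
  The constant 30 in \<open>M\<close> also covers \<open>n + 24\<close>, the end of the flags, when
  \<open>n\<close> is small.\<close>

lemma size_bounds:
  "n \<le> M" "n + 24 \<le> M" "30 \<le> M" "k \<le> M" "\<kappa> \<le> M" "min n w * len \<le> M" "\<mu> * len \<le> M" "2 * D \<le> M" "B \<le> M"
  "b * n + B \<le> M" "b * n + 2 * D \<le> M" "len \<le> M" "4 * n \<le> M"
proof -
  have pow: "n ^ i \<le> n ^ 4" if "i \<le> 4" for i using n_pos that by (intro power_increasing) auto
  have mpow: "c * n ^ i \<le> c * \<mu> * n ^ 4" if "i \<le> 4" for c i
  proof -
    have "c * n ^ i \<le> c * 1 * n ^ 4" using pow[OF that] by simp
    also have "\<dots> \<le> c * \<mu> * n ^ 4" using mu_pos by (intro mult_le_mono) auto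
    finally show ?thesis .
  qed
  have "30 * n ^ 1 \<le> M" using mpow[of 1 30] by (simp add: M_def)
  then have n30: "30 * n \<le> M" by simp
  with n_pos show "n \<le> M" "n + 24 \<le> M" "30 \<le> M" "len \<le> M" "4 * n \<le> M" using len_le by linarith+
  have W: "min n w * len \<le> n * n" using len_le by (intro mult_le_mono) auto
  then have k: "k \<le> 2 * n ^ 2" using kappa(3) by (simp add: power2_eq_square)
  also have "\<dots> \<le> M" using mpow[of 2 2] by (simp add: M_def)
  finally show kM: "k \<le> M" .
  have "\<kappa> < k" unfolding k_def by simp
  then show "\<kappa> \<le> M" using kM by simp
  show "min n w * len \<le> M" using kappa(2) kM by simp
  have D: "D \<le> 2 * n ^ 2 * (\<mu> * n)" unfolding D_def using k len_le by (intro mult_le_mono) auto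
  then have D: "D \<le> 2 * \<mu> * n ^ 3" by (simp add: power2_eq_square power3_eq_cube algebra_simps)
  also have "\<dots> \<le> 2 * \<mu> * n ^ 4" using pow by (intro mult_le_mono) auto
  finally have D4: "D \<le> 2 * (\<mu> * n ^ 4)" by simp
  have M: "M = 30 * (\<mu> * n ^ 4)" by (simp add: M_def)
  show DM: "2 * D \<le> M" using D4 M by simp
  have "1 * (\<mu> * len) \<le> D" unfolding D_def using k_ge by (intro mult_le_mono) auto
  then show "\<mu> * len \<le> M" using DM by simp
  have "D * n \<le> 2 * \<mu> * n ^ 3 * n" using D by (intro mult_le_mono) auto
  then have Dn: "D * n \<le> 2 * (\<mu> * n ^ 4)" by (simp add: power3_eq_cube power4_eq_xxxx algebra_simps)
  have B: "B \<le> 8 * (\<mu> * n ^ 4)" using Dn D4 by (simp add: B_def algebra_simps)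
  show "B \<le> M" using B M by linarith
  have "b * n \<le> 2 * D * n" using b_le by (intro mult_le_mono) auto
  then have bn: "b * n \<le> 4 * (\<mu> * n ^ 4)" using Dn by linarith
  show "b * n + B \<le> M" "b * n + 2 * D \<le> M" using bn B M D4 by linarith+
qed

sublocale machine n T a M
  using size_bounds(3) by unfold_locales simp

text \<open>The bound on \<open>q\<close> is \<open>2 * n\<close> because the last raise starts
  below \<open>n\<close> and may overshoot it.\<close>

definition ready :: "mem \<Rightarrow> nat \<Rightarrow> nat set \<Rightarrow> nat \<Rightarrow> bool" where
  "ready m \<rho> A q \<longleftrightarrow> m 0 = n \<and> m 6 = k \<and> m 7 = D \<and> m 8 = 2 * D \<and> m 9 = b \<and> m 10 = \<rho> \<and>
     m 11 = b * (card A div 2) \<and> m 12 = q \<and> (\<forall>v<n. m (v + 24) = of_bool (v \<in> A)) \<and>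
     \<rho> \<le> B \<and> q \<le> 2 * n \<and> A \<subseteq> {..<n}"

definition start_level :: nat where "start_level = (if w < n then 0 else n)"

section \<open>Correctness of the preprocessing\<close>

lemma sim_len_loop:
  assumes "ok m" and "m 14 + floorlog 2 (m 13) \<le> M"
  shows "sim (While 13 (Half 13 (Cell 13) ;; Add 14 (Cell 14) (Imm 1))) m (3 * floorlog 2 (m 13) + 1)
    (return_pmf ()) (\<lambda>m' _. m' 14 = m 14 + floorlog 2 (m 13) \<and> (\<forall>j. j \<notin> {13, 14} \<longrightarrow> m' j = m j))"
  using assms
proof (induction "floorlog 2 (m 13)" arbitrary: m)
  case 0
  then have "m 13 = 0" by (simp add: floorlog_eq_zero_iff)
  then show ?case
    using 0 by (intro sim_mono[OF sim_While_exit[where R = "\<lambda>m' _. m' = m"]]) auto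
next
  case (Suc c)
  let ?b = "Half 13 (Cell 13) ;; Add 14 (Cell 14) (Imm 1)"
  let ?m = "m(13 := m 13 div 2, 14 := m 14 + 1)"
  have "m 13 \<noteq> 0" using Suc.hyps(2) by (cases "m 13 = 0") (auto simp: floorlog_def)
  then have c: "floorlog 2 (m 13 div 2) = c"
    using Suc.hyps(2) compute_floorlog[of 2 "m 13"] by simp
  have "m 13 div 2 \<le> M" using ok_le[OF Suc.prems(1), of 13] by simp
  then have ok1: "ok (m(13 := m 13 div 2))" using Suc.prems by auto
  have ok: "ok ?m" by (rule memory_ok_upd[OF ok1]) (use Suc.prems(2) Suc.hyps(2) in auto)
  let ?Q = "\<lambda>m'. m' 14 = m 14 + Suc c \<and> (\<forall>j. j \<notin> {13, 14} \<longrightarrow> m' j = m j)"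
  have "sim (While 13 ?b) m (Suc (Suc (Suc 0) + (3 * c + 1))) (bind_pmf (return_pmf ()) (\<lambda>_. return_pmf ())) (\<lambda>m' _. ?Q m')"
  proof (rule sim_While_step[where R = "\<lambda>m' _. m' = ?m"])
    show "sim ?b m (Suc (Suc 0)) (return_pmf ()) (\<lambda>m' _. m' = ?m)"
      by (rule sim_Seq_tick[OF _ Suc.prems(1) ok1], simp,
          rule sim_tick[OF _ ok1 ok]) auto
    show "sim (While 13 ?b) m' (3 * c + 1) (return_pmf ()) (\<lambda>m' _. ?Q m')" if "m' = ?m" for m'
      unfolding that
      by (rule sim_mono[OF Suc.hyps(1)[of ?m]]) (use c ok Suc.prems(2) Suc.hyps(2) in auto)
  qed (use Suc \<open>m 13 \<noteq> 0\<close> in auto)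
  then show ?case unfolding bind_return_pmf Suc.hyps(2)[symmetric] by (rule sim_mono) auto
qed

lemma sim_k_loop:
  assumes "ok m" and "m 6 = 2 ^ i" and "1 \<le> i" and "i \<le> \<kappa>" and "m 15 = min n w * len"
    and "m 13 = m 15 - m 6"
  shows "sim (While 13 (Add 6 (Cell 6) (Cell 6) ;; Sub 13 (Cell 15) (Cell 6))) m (3 * (\<kappa> - i) + 1)
    (return_pmf ()) (\<lambda>m' _. m' 6 = k \<and> (\<forall>j. j \<notin> {6, 13} \<longrightarrow> m' j = m j))"
  using assms
proof (induction "\<kappa> - i" arbitrary: m i)
  case 0
  then have "i = \<kappa>" by simp
  then have "m 6 = k" "m 13 = 0" using 0 kappa(2) by (auto simp: k_def)
  then show ?case
    using 0 by (intro sim_mono[OF sim_While_exit[where R = "\<lambda>m' _. m' = m"]]) auto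
next
  case (Suc c)
  let ?b = "Add 6 (Cell 6) (Cell 6) ;; Sub 13 (Cell 15) (Cell 6)"
  let ?m = "m(6 := 2 ^ Suc i, 13 := m 15 - 2 ^ Suc i)"
  have i: "Suc i \<le> \<kappa>" using Suc.hyps(2) by simp
  \<comment> \<open>By leastness of \<open>\<kappa>\<close>, a smaller power of two does not reach
    \<open>min n w * len\<close>, so the loop goes on.\<close>
  then have "\<not> (1 \<le> i \<and> min n w * len \<le> 2 ^ i)"
    unfolding \<kappa>_def by (intro not_less_Least) simp
  then have ne: "m 13 \<noteq> 0" using Suc.prems by simp
  have "2 ^ Suc i \<le> k" unfolding k_def using i by (intro power_increasing) auto
  then have ok1: "ok (m(6 := 2 ^ Suc i))" using Suc.prems(1) size_bounds(4) by auto
  have "m 15 - 2 ^ Suc i \<le> M" using size_bounds(6) Suc.prems(5) by simp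
  then have ok: "ok ?m" using ok1 by auto
  let ?Q = "\<lambda>m'. m' 6 = k \<and> (\<forall>j. j \<notin> {6, 13} \<longrightarrow> m' j = m j)"
  have "sim (While 13 ?b) m (Suc (Suc (Suc 0) + (3 * c + 1))) (bind_pmf (return_pmf ()) (\<lambda>_. return_pmf ())) (\<lambda>m' _. ?Q m')"
  proof (rule sim_While_step[where R = "\<lambda>m' _. m' = ?m"])
    show "sim ?b m (Suc (Suc 0)) (return_pmf ()) (\<lambda>m' _. m' = ?m)"
      by (rule sim_Seq_tick[OF _ Suc.prems(1) ok1], simp add: Suc.prems(2) mult_2,
          rule sim_tick[OF _ ok1 ok]) auto
    show "sim (While 13 ?b) m' (3 * c + 1) (return_pmf ()) (\<lambda>m' _. ?Q m')" if "m' = ?m" for m'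
      unfolding that
      by (rule sim_mono[OF Suc.hyps(1)[of "Suc i" ?m]]) (use ok Suc.prems Suc.hyps(2) i in auto)
  qed (use Suc ne in auto)
  then show ?case unfolding bind_return_pmf Suc.hyps(2)[symmetric] by (rule sim_mono) auto
qed

text \<open>The suffixes \<open>?c1\<close> to \<open>?c5\<close> of the program are verified from
  the last to the first, each under hypotheses on the cells it still reads; \<open>base\<close>
  collects cells that most of them pass on unchanged.\<close>

lemma sim_preprocess:
  "sim (preprocess \<mu> w b\<^sub>0) (init_mem n T a) (100 * (M * M)) (geo r B)
     (\<lambda>m \<rho>. ready m \<rho> {} start_level)"
proof -
  let ?c1 = "sample ;; mov 10 (Cell 17)"
  let ?c2 = "Add 8 (Cell 7) (Cell 7) ;; Sub 13 (Cell 8) (Imm b\<^sub>0) ;; Sub 9 (Cell 8) (Cell 13) ;;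
     Add 13 (Cell 0) (Imm 1) ;; mul 16 (Cell 8) (Cell 13) ;; ?c1"
  let ?c3 = "mul 15 (Imm \<mu>) (Cell 14) ;; mul 7 (Cell 6) (Cell 15) ;; ?c2"
  let ?c4 = "mov 6 (Imm 2) ;; Sub 13 (Cell 15) (Cell 6) ;;
     While 13 (Add 6 (Cell 6) (Cell 6) ;; Sub 13 (Cell 15) (Cell 6)) ;; ?c3"
  let ?c5 = "Sub 13 (Cell 0) (Imm w) ;; Sub 22 (Cell 0) (Cell 13) ;;
     If 13 Skip (mov 12 (Cell 0)) ;; mul 15 (Cell 22) (Cell 14) ;; ?c4"
  let ?R = "\<lambda>m \<rho>. ready m \<rho> {} start_level"
  define base where "base q m \<longleftrightarrow> m 0 = n \<and> m 11 = 0 \<and> m 12 = q \<and> (\<forall>j\<ge>24. m j = 0)"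
    for q :: nat and m :: mem
  define \<tau>1 where "\<tau>1 = ((6 * \<kappa> + 8) * B + 2) + Suc 0"
  define \<tau>2 where "\<tau>2 = Suc (Suc (Suc (Suc (3 * (n + 1) + 3 + \<tau>1))))"
  define \<tau>3 where "\<tau>3 = (3 * len + 3) + ((3 * (\<mu> * len) + 3) + \<tau>2)"
  define \<tau>4 where "\<tau>4 = Suc (Suc ((3 * (\<kappa> - 1) + 1) + \<tau>3))"
  define \<tau>5 where "\<tau>5 = Suc (Suc (Suc (Suc 0 + Suc 0) + ((3 * len + 3) + \<tau>4)))"
  have 1: "sim ?c1 m \<tau>1 (geo r B) ?R"
    if "ok m" "base start_level m" "m 6 = k" "m 7 = D" "m 8 = 2 * D" "m 9 = b" "m 16 = B" for m
  proof -
    have "sim ?c1 m \<tau>1 (bind_pmf (geo (1 - (1/2) ^ \<kappa>) (m 16)) return_pmf) ?R"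
      unfolding \<tau>1_def that(7)[symmetric]
    proof (rule sim_Seq[OF sim_sample[OF that(1)]])
      show "m 6 = 2 ^ \<kappa>" using that by (simp add: k_def)
      fix m' \<rho>
      assume ok: "ok m'" and m': "m' 17 = \<rho> \<and> \<rho> \<le> m 16 \<and> (\<forall>j. j \<notin> {16, 17, 18, 19, 20} \<longrightarrow> m' j = m j)"
      have "\<rho> \<le> M" using m' that size_bounds(9) by simp
      then have ok': "ok (m'(10 := \<rho>))" using ok by auto
      show "sim (mov 10 (Cell 17)) m' (Suc 0) (return_pmf \<rho>) ?R"
        by (rule sim_tick[OF _ ok ok'])
           (use m' that in \<open>auto simp: ready_def base_def start_level_def\<close>)
    qed
    then show ?thesis unfolding bind_return_pmf' r_def that(7) .
  qed
  have 2: "sim ?c2 m \<tau>2 (geo r B) ?R"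
    if ok: "ok m" and m: "base start_level m" "m 6 = k" "m 7 = D" for m
  proof -
    \<comment> \<open>Truncated subtraction computes minima, as
      \<open>x - (x - y) = min x y\<close>: here for \<open>b\<close>, and likewise for
      \<open>min n w\<close> in \<open>?c5\<close>.\<close>
    let ?m1 = "m(8 := 2 * D)" let ?m2 = "?m1(13 := 2 * D - b\<^sub>0)"
    let ?m3 = "?m2(9 := b)" let ?m4 = "?m3(13 := n + 1)"
    have ok1: "ok ?m1" using ok size_bounds by auto
    have ok2: "ok ?m2" using ok1 size_bounds by auto
    have ok3: "ok ?m3" using b_le size_bounds by (intro memory_ok_upd[OF ok2]) auto
    have ok4: "ok ?m4" using size_bounds by (intro memory_ok_upd[OF ok3]) auto
    have mul: "sim (mul 16 (Cell 8) (Cell 13)) ?m4 (3 * (n + 1) + 3) (return_pmf ())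
       (\<lambda>m' _. m' 16 = B \<and> (\<forall>j. j \<noteq> 16 \<longrightarrow> j \<noteq> 21 \<longrightarrow> m' j = ?m4 j))"
      by (rule sim_mono[OF sim_mul[OF ok4]]) (use size_bounds in \<open>auto simp: B_def\<close>)
    have "sim (mul 16 (Cell 8) (Cell 13) ;; ?c1) ?m4 (3 * (n + 1) + 3 + \<tau>1) (geo r B) ?R"
      by (rule sim_Seq_det[OF mul]) (rule 1, use m in \<open>auto simp: base_def\<close>)
    then show ?thesis
      unfolding \<tau>2_def
      by (intro sim_Seq_tick[OF _ ok ok1] sim_Seq_tick[OF _ ok1 ok2] sim_Seq_tick[OF _ ok2 ok3]
            sim_Seq_tick[OF _ ok3 ok4])
         (use m in \<open>auto simp: base_def b_def min_def mult_2\<close>)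
  qed
  have 3: "sim ?c3 m \<tau>3 (geo r B) ?R"
    if ok: "ok m" and m: "base start_level m" "m 6 = k" "m 14 = len" for m
    unfolding \<tau>3_def m(3)[symmetric]
  proof (rule sim_Seq_det)
    show "sim (mul 15 (Imm \<mu>) (Cell 14)) m (3 * m 14 + 3) (return_pmf ())
       (\<lambda>m' _. m' 15 = \<mu> * len \<and> (\<forall>j. j \<noteq> 15 \<longrightarrow> j \<noteq> 21 \<longrightarrow> m' j = m j))"
      by (rule sim_mono[OF sim_mul[OF ok]]) (use m size_bounds in auto)
    fix m' assume ok': "ok m'" and m': "m' 15 = \<mu> * len \<and> (\<forall>j. j \<noteq> 15 \<longrightarrow> j \<noteq> 21 \<longrightarrow> m' j = m j)"
    show "sim (mul 7 (Cell 6) (Cell 15) ;; ?c2) m' (3 * (\<mu> * m 14) + 3 + \<tau>2) (geo r B) ?R"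
    proof (rule sim_Seq_det)
      show "sim (mul 7 (Cell 6) (Cell 15)) m' (3 * (\<mu> * m 14) + 3) (return_pmf ())
        (\<lambda>m'' _. m'' 7 = D \<and> (\<forall>j. j \<noteq> 7 \<longrightarrow> j \<noteq> 21 \<longrightarrow> m'' j = m' j))"
        by (rule sim_mono[OF sim_mul[OF ok']])
           (use m m' size_bounds(7,8) in \<open>auto simp: D_def\<close>)
      fix m'' assume "ok m''" "m'' 7 = D \<and> (\<forall>j. j \<noteq> 7 \<longrightarrow> j \<noteq> 21 \<longrightarrow> m'' j = m' j)"
      then show "sim ?c2 m'' \<tau>2 (geo r B) ?R"
        by (intro 2) (use m m' in \<open>auto simp: base_def\<close>)
    qed
  qed
  have 4: "sim ?c4 m \<tau>4 (geo r B) ?R"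
    if ok: "ok m" and m: "base start_level m" "m 14 = len" "m 15 = min n w * len" for m
  proof -
    let ?m1 = "m(6 := 2)" let ?m2 = "?m1(13 := m 15 - 2)"
    have ok1: "ok ?m1" using ok size_bounds(3) by auto
    have ok2: "ok ?m2" using size_bounds(6) m by (intro memory_ok_upd[OF ok1]) auto
    have "sim (While 13 (Add 6 (Cell 6) (Cell 6) ;; Sub 13 (Cell 15) (Cell 6))) ?m2 (3 * (\<kappa> - 1) + 1)
      (return_pmf ()) (\<lambda>m' _. m' 6 = k \<and> (\<forall>j. j \<notin> {6, 13} \<longrightarrow> m' j = ?m2 j))"
      by (rule sim_k_loop[OF ok2]) (use m kappa(1) in auto)
    then have "sim (While 13 (Add 6 (Cell 6) (Cell 6) ;; Sub 13 (Cell 15) (Cell 6)) ;; ?c3) ?m2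
        (3 * (\<kappa> - 1) + 1 + \<tau>3) (geo r B) ?R"
      by (rule sim_Seq_det) (rule 3, use m in \<open>auto simp: base_def\<close>)
    then show ?thesis
      unfolding \<tau>4_def
      by (intro sim_Seq_tick[OF _ ok ok1] sim_Seq_tick[OF _ ok1 ok2]) auto
  qed
  have 5: "sim ?c5 m \<tau>5 (geo r B) ?R"
    if ok: "ok m" and m: "base 0 m" "m 14 = len" for m
  proof -
    let ?m1 = "m(13 := n - w)" let ?m2 = "?m1(22 := min n w)" let ?m3 = "?m2(12 := start_level)"
    have ok1: "ok ?m1" using ok size_bounds(1) by auto
    have ok2: "ok ?m2" using size_bounds(1) by (intro memory_ok_upd[OF ok1]) auto
    have ok3: "ok ?m3" using size_bounds(1) by (intro memory_ok_upd[OF ok2]) (auto simp: start_level_def)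
    have m3: "?m3 = ?m2" if "w < n"
      using that m by (auto simp: start_level_def base_def fun_eq_iff)
    have If: "sim (If 13 Skip (mov 12 (Cell 0))) ?m2 (Suc (Suc 0 + Suc 0)) (return_pmf ()) (\<lambda>m' _. m' = ?m3)"
    proof (rule sim_If[OF ok2])
      assume "?m2 13 \<noteq> 0"
      then have w: "w < n" by simp
      show "sim Skip ?m2 (Suc 0) (return_pmf ()) (\<lambda>m' _. m' = ?m3)"
        unfolding m3[OF w] by (rule sim_tick[OF _ ok2 ok2]) auto
    next
      assume "?m2 13 = 0"
      then have w: "\<not> w < n" by simp
      show "sim (mov 12 (Cell 0)) ?m2 (Suc 0) (return_pmf ()) (\<lambda>m' _. m' = ?m3)"
        by (rule sim_tick[OF _ ok2 ok3]) (use w m in \<open>auto simp: start_level_def base_def\<close>)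
    qed
    have mul: "sim (mul 15 (Cell 22) (Cell 14)) ?m3 (3 * len + 3) (return_pmf ())
       (\<lambda>m' _. m' 15 = min n w * len \<and> (\<forall>j. j \<noteq> 15 \<longrightarrow> j \<noteq> 21 \<longrightarrow> m' j = ?m3 j))"
      by (rule sim_mono[OF sim_mul[OF ok3]]) (use m size_bounds in auto)
    have "sim (mul 15 (Cell 22) (Cell 14) ;; ?c4) ?m3 (3 * len + 3 + \<tau>4) (geo r B) ?R"
      by (rule sim_Seq_det[OF mul]) (rule 4, use m in \<open>auto simp: base_def\<close>)
    then have "sim (If 13 Skip (mov 12 (Cell 0)) ;; mul 15 (Cell 22) (Cell 14) ;; ?c4) ?m2
        (Suc (Suc 0 + Suc 0) + (3 * len + 3 + \<tau>4)) (geo r B) ?R"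
      by (intro sim_Seq_det[OF If]) auto
    then show ?thesis
      unfolding \<tau>5_def
      by (intro sim_Seq_tick[OF _ ok ok1] sim_Seq_tick[OF _ ok1 ok2])
         (use m in \<open>auto simp: base_def min_def\<close>)
  qed
  let ?m0 = "init_mem n T a" and ?m1 = "(init_mem n T a)(13 := n)"
  have ok0: "ok ?m0" using size_bounds(1) by (auto simp: memory_ok_def init_mem_def)
  have ok1: "ok ?m1" using ok0 size_bounds(1) by auto
  have "sim (While 13 (Half 13 (Cell 13) ;; Add 14 (Cell 14) (Imm 1))) ?m1 (3 * len + 1) (return_pmf ())
    (\<lambda>m' _. m' 14 = len \<and> (\<forall>j. j \<notin> {13, 14} \<longrightarrow> m' j = ?m1 j))"
    by (rule sim_mono[OF sim_len_loop[OF ok1]])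
       (use size_bounds(12) in \<open>auto simp: init_mem_def simp flip: len_def\<close>)
  then have "sim (While 13 (Half 13 (Cell 13) ;; Add 14 (Cell 14) (Imm 1)) ;; ?c5) ?m1
     (3 * len + 1 + \<tau>5) (geo r B) ?R"
    by (rule sim_Seq_det) (rule 5, auto simp: base_def init_mem_def)
  then have "sim (preprocess \<mu> w b\<^sub>0) ?m0 (Suc (3 * len + 1 + \<tau>5)) (geo r B) ?R"
    unfolding preprocess_def by (intro sim_Seq_tick[OF _ ok0 ok1]) (auto simp: init_mem_def)
  then show ?thesis
  proof (rule sim_mono)
    \<comment> \<open>Sampling the noise dominates the time: at most \<open>B\<close> trials of at
      most \<open>6 * \<kappa> + 8\<close> steps each.\<close>
    have "(6 * \<kappa> + 8) * B \<le> (6 * M + 8 * M) * M"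
      using size_bounds by (intro mult_le_mono add_mono) auto
    then have z: "(6 * \<kappa> + 8) * B \<le> 14 * (M * M)" by (simp add: distrib_right)
    have "M * 1 \<le> M * M" using size_bounds by (intro mult_le_mono) auto
    moreover have "\<kappa> - 1 \<le> M" using size_bounds by linarith
    \<comment> \<open>The product and the truncated \<open>\<kappa> - 1\<close> are abstracted to
      variables, so that unfolding the budgets leaves a linear identity.\<close>
    moreover have "Suc (3 * len + 1 + \<tau>5) = z + 3 * y + (9 * len + 3 * (\<mu> * len) + 3 * n + 32)"
      if "z = (6 * \<kappa> + 8) * B" "y = \<kappa> - 1" for y z
      unfolding \<tau>5_def \<tau>4_def \<tau>3_def \<tau>2_def \<tau>1_def that[symmetric] by simp
    note this[OF refl refl]
    ultimately show "Suc (3 * len + 1 + \<tau>5) \<le> 100 * (M * M)"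
      using z size_bounds(1,3,7,12) by linarith
  qed auto
qed

section \<open>Correctness of one update\<close>

lemma sim_match_edge:
  assumes ok: "ok m" and m: "ready m \<rho> A q" and u: "edge_updates n [u]"
    and io: "m 3 = (case u of None \<Rightarrow> 0 | Some e \<Rightarrow> Min e)" "m 4 = (case u of None \<Rightarrow> 0 | Some e \<Rightarrow> Max e)"
  shows "sim match_edge m 20 (return_pmf ()) (\<lambda>m' _. ready m' \<rho> (absorb A u) q)"
proof (cases u)
  case None
  have ok1: "ok (m(13 := 0))" using ok by auto
  have "sim match_edge m (Suc (Suc (0 + Suc 0))) (return_pmf ()) (\<lambda>m' _. ready m' \<rho> (absorb A u) q)"
    unfolding match_edge_def
    apply (rule sim_Seq_tick[OF _ ok ok1])
     apply (simp add: io None)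
    apply (rule sim_If[OF ok1])
     apply simp
    apply (rule sim_tick[OF _ ok1 ok1])
     apply (use m None in \<open>auto simp: ready_def absorb_def\<close>)
    done
  then show ?thesis by (rule sim_mono) auto
next
  case (Some e)
  then obtain x y where e: "x < y" "y < n" "e = {x, y}" using u by (auto elim: is_edgeE)
  have xy: "m 3 = x" "m 4 = y" using io e Some by auto
  have f: "m (x + 24) = of_bool (x \<in> A)" "m (y + 24) = of_bool (y \<in> A)"
    using m e by (auto simp: ready_def)
  have A: "A \<subseteq> {..<n}" using m by (simp add: ready_def)
  have absorb: "absorb A u = (if x \<in> A \<or> y \<in> A then A else A \<union> {x, y})"
    using Some e by (auto simp: absorb_def disjnt_def)
  let ?s = "of_bool (x \<in> A) + of_bool (y \<in> A) :: nat"
  let ?m1 = "m(13 := y - x)" let ?m2 = "m(13 := x + 24)" let ?m3 = "?m2(14 := y + 24)"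
  let ?m4 = "?m3(15 := of_bool (x \<in> A))" let ?m5 = "?m4(16 := of_bool (y \<in> A))"
  let ?m6 = "?m5(15 := ?s)"
  let ?m7 = "?m6(x + 24 := 1)" let ?m8 = "?m7(y + 24 := 1)" let ?m9 = "?m8(11 := m 11 + b)"
  let ?R = "\<lambda>m' _. ready m' \<rho> (absorb A u) q"
  have ok1: "ok ?m1" using ok e size_bounds(1) by auto
  have ok2: "ok ?m2" using ok e size_bounds(2) by auto
  have ok3: "ok ?m3" using e size_bounds(2) by (intro memory_ok_upd[OF ok2]) auto
  have ok4: "ok ?m4" using size_bounds(3) by (intro memory_ok_upd[OF ok3]) auto
  have ok5: "ok ?m5" using size_bounds(3) by (intro memory_ok_upd[OF ok4]) auto
  have ok6: "ok ?m6" using size_bounds(3) by (intro memory_ok_upd[OF ok5]) auto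
  have inner: "sim (If 15 Skip (Store (Cell 13) (Imm 1) ;; Store (Cell 14) (Imm 1) ;; Add 11 (Cell 11) (Cell 9)))
      ?m6 (Suc (Suc 0 + Suc (Suc (Suc 0)))) (return_pmf ()) ?R"
  proof (rule sim_If[OF ok6])
    assume "?m6 15 \<noteq> 0"
    then have "absorb A u = A" using absorb by auto
    then show "sim Skip ?m6 (Suc 0) (return_pmf ()) ?R"
      by (intro sim_tick[OF _ ok6 ok6]) (use m in \<open>auto simp: ready_def\<close>)
  next
    assume "?m6 15 = 0"
    then have na: "x \<notin> A" "y \<notin> A" by auto
    then have au: "absorb A u = A \<union> {x, y}" using absorb by auto
    have fin: "finite A" using A finite_subset by blast
    have card: "card (insert x (insert y A)) = card A + 2" using na e fin by simp
    have sub: "insert x (insert y A) \<subseteq> {..<n}" using A e by auto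
    then have "card (insert x (insert y A)) \<le> n" using card_mono[OF _ sub] by simp
    then have "b * ((card A + 2) div 2) \<le> b * n" unfolding card by (intro mult_le_mono) auto
    then have "m 11 + b \<le> M" using m size_bounds(10) by (simp add: ready_def)
    have ok7: "ok ?m7" using e by (intro memory_ok_flag[OF ok6]) auto
    have ok8: "ok ?m8" using e by (intro memory_ok_flag[OF ok7]) auto
    have ok9: "ok ?m9" using \<open>m 11 + b \<le> M\<close> by (intro memory_ok_upd[OF ok8]) auto
    have m9: "ready ?m9 \<rho> (absorb A u) q"
      using m sub card unfolding au by (auto simp: ready_def)
    show "sim (Store (Cell 13) (Imm 1) ;; Store (Cell 14) (Imm 1) ;; Add 11 (Cell 11) (Cell 9)) ?m6
      (Suc (Suc (Suc 0))) (return_pmf ()) ?R"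
      apply (rule sim_Seq_tick[OF _ ok6 ok7], simp)
      apply (rule sim_Seq_tick[OF _ ok7 ok8], simp)
      apply (rule sim_tick[OF _ ok8 ok9])
       apply (use m m9 in \<open>auto simp: ready_def\<close>)
      done
  qed
  have "sim (Add 13 (Cell 3) (Imm 24) ;; Add 14 (Cell 4) (Imm 24) ;;
        Load 15 (Cell 13) ;; Load 16 (Cell 14) ;; Add 15 (Cell 15) (Cell 16) ;;
        If 15 Skip (Store (Cell 13) (Imm 1) ;; Store (Cell 14) (Imm 1) ;; Add 11 (Cell 11) (Cell 9)))
      ?m1 (Suc (Suc (Suc (Suc (Suc (Suc (Suc 0 + Suc (Suc (Suc 0))))))))) (return_pmf ()) ?R"
    apply (rule sim_Seq_tick[OF _ ok1 ok2], simp add: xy)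
    apply (rule sim_Seq_tick[OF _ ok2 ok3], simp add: xy)
    apply (rule sim_Seq_tick[OF _ ok3 ok4], simp add: f)
    apply (rule sim_Seq_tick[OF _ ok4 ok5], simp add: f)
    apply (rule sim_Seq_tick[OF _ ok5 ok6], simp)
    apply (rule inner)
    done
  then have "sim match_edge m (Suc (Suc ((Suc (Suc (Suc (Suc (Suc (Suc (Suc 0 + Suc (Suc (Suc 0)))))))))
     + 0))) (return_pmf ()) ?R"
    unfolding match_edge_def using e
    by (intro sim_Seq_tick[OF _ ok ok1] sim_If[OF ok1]) (auto simp: xy)
  then show ?thesis by (rule sim_mono) auto
qed

text \<open>By \<open>geo_full\<close>, asking whether a capped sample has reached its cap is the
  Bernoulli trial of \<open>step\<close>.\<close>

lemma step_conv_geo: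
  assumes "q < n"
  shows "step \<rho> q g = bind_pmf (geo r (expo \<rho> q g))
    (\<lambda>i. return_pmf (if i = expo \<rho> q g then next_level q else q))"
proof -
  have "bernoulli_pmf (r ^ expo \<rho> q g) = map_pmf (\<lambda>i. i = expo \<rho> q g) (geo r (expo \<rho> q g))"
    using r_bounds by (intro geo_full[symmetric]) auto
  then show ?thesis
    using assms by (simp add: step_def pmf.map_comp o_def map_pmf_def[symmetric])
qed

lemma sim_raise_level:
  assumes ok: "ok m" and m: "ready m \<rho> A q"
  shows "sim raise_level m (50 * (M * M)) (step \<rho> q (card A div 2)) (\<lambda>m' q'. ready m' \<rho> A q')"
proof -
  let ?m1 = "m(13 := n - q)"
  have ok1: "ok ?m1" using ok size_bounds(1) by auto
  have mf: "m 0 = n" "m 6 = k" "m 7 = D" "m 8 = 2 * D" "m 9 = b" "m 10 = \<rho>"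
     "m 11 = b * (card A div 2)" "m 12 = q" "\<rho> \<le> B" "A \<subseteq> {..<n}"
    using m by (auto simp: ready_def)
  have MM: "30 * M \<le> M * M" using size_bounds(3) by (intro mult_le_mono) auto
  show ?thesis
  proof (cases "n \<le> q")
    case True
    have "sim raise_level m (Suc (Suc (0 + Suc 0))) (return_pmf q) (\<lambda>m' q'. ready m' \<rho> A q')"
      unfolding raise_level_def
      apply (rule sim_Seq_tick[OF _ ok ok1], simp add: mf)
      apply (rule sim_If[OF ok1], use True in simp)
      apply (rule sim_tick[OF _ ok1 ok1])
       apply (use m in \<open>auto simp: ready_def\<close>)
      done
    moreover have "Suc (Suc (0 + Suc 0)) \<le> 50 * (M * M)" using MM size_bounds(3) by linarith
    ultimately show ?thesis
      using True by (auto simp: step_def elim!: sim_mono)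
  next
    case False
    then have q: "q < n" by simp
    let ?g = "card A div 2"
    let ?P = "b * (q + 1) + \<rho>" and ?X = "expo \<rho> q ?g"
    have bq: "b * (q + 1) \<le> b * n" using q by (intro mult_le_mono) auto
    have "card A \<le> n" using card_mono[OF _ mf(10)] by simp
    then have bg: "b * ?g \<le> b * n" by (intro mult_le_mono) auto
    let ?m2 = "?m1(14 := q + 1)"
    have ok2: "ok ?m2" using q size_bounds(1) by (intro memory_ok_upd[OF ok1]) auto
    let ?R = "\<lambda>m' q'. ready m' \<rho> A q'"
    have last: "sim (Sub 13 (Cell 22) (Cell 17) ;; If 13 Skip (Half 13 (Cell 14) ;; Add 12 (Cell 14) (Cell 13)))
       m' 6 (return_pmf (if i = ?X then next_level q else q)) ?R"
      if ok': "ok m'" and m': "ready m' \<rho> A q" "m' 22 = ?X" "m' 17 = i" "i \<le> ?X" "m' 14 = q + 1" for m' i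
    proof -
      let ?m1 = "m'(13 := ?X - i)" let ?m2 = "?m1(13 := (q + 1) div 2)" let ?m3 = "?m2(12 := next_level q)"
      have ok1: "ok ?m1" using ok' size_bounds(8) by (auto simp: expo_def)
      have ok2: "ok ?m2" using q size_bounds(1) by (intro memory_ok_upd[OF ok1]) auto
      have nl: "next_level q \<le> 2 * n" using q by (auto simp: next_level_def)
      have ok3: "ok ?m3" using size_bounds(13) nl by (intro memory_ok_upd[OF ok2]) auto
      have "sim (If 13 Skip (Half 13 (Cell 14) ;; Add 12 (Cell 14) (Cell 13))) ?m1
         (Suc (Suc 0 + Suc (Suc 0))) (return_pmf (if i = ?X then next_level q else q)) ?R"
      proof (rule sim_If[OF ok1])
        assume "?m1 13 \<noteq> 0"
        then show "sim Skip ?m1 (Suc 0) (return_pmf (if i = ?X then next_level q else q)) ?R"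
          by (intro sim_tick[OF _ ok1 ok1]) (use m' in \<open>auto simp: ready_def\<close>)
      next
        assume "?m1 13 = 0"
        then have "i = ?X" using m' by simp
        then show "sim (Half 13 (Cell 14) ;; Add 12 (Cell 14) (Cell 13)) ?m1 (Suc (Suc 0))
           (return_pmf (if i = ?X then next_level q else q)) ?R"
          apply (intro sim_Seq_tick[OF _ ok1 ok2])
           apply (simp add: m')
          apply (rule sim_tick[OF _ ok2 ok3])
           apply (use m' nl in \<open>auto simp: ready_def next_level_def\<close>)
          done
      qed
      then have "sim (Sub 13 (Cell 22) (Cell 17) ;; If 13 Skip (Half 13 (Cell 14) ;; Add 12 (Cell 14) (Cell 13)))
        m' (Suc (Suc (Suc 0 + Suc (Suc 0)))) (return_pmf (if i = ?X then next_level q else q)) ?R"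
        by (intro sim_Seq_tick[OF _ ok' ok1]) (use m' in auto)
      then show ?thesis by (rule sim_mono) auto
    qed
    let ?c1 = "sample ;; Sub 13 (Cell 22) (Cell 17) ;; If 13 Skip (Half 13 (Cell 14) ;; Add 12 (Cell 14) (Cell 13))"
    have samp: "sim ?c1 m' ((6 * \<kappa> + 8) * ?X + 2 + 6) (step \<rho> q ?g) ?R"
      if ok': "ok m'" and m': "ready m' \<rho> A q" "m' 22 = ?X" "m' 16 = ?X" "m' 14 = q + 1" for m'
    proof -
      have eq: "step \<rho> q ?g = bind_pmf (geo (1 - (1/2) ^ \<kappa>) (m' 16))
          (\<lambda>i. return_pmf (if i = m' 16 then next_level q else q))"
        unfolding m'(3) r_def[symmetric] by (rule step_conv_geo[OF q])
      show ?thesis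
        unfolding eq m'(3)[symmetric]
      proof (rule sim_Seq[OF sim_sample[OF ok']])
        show "m' 6 = 2 ^ \<kappa>" using m' by (simp add: ready_def k_def)
        fix m'' i
        assume "ok m''" "m'' 17 = i \<and> i \<le> m' 16 \<and> (\<forall>j. j \<notin> {16, 17, 18, 19, 20} \<longrightarrow> m'' j = m' j)"
        then show "sim (Sub 13 (Cell 22) (Cell 17) ;; If 13 Skip (Half 13 (Cell 14) ;; Add 12 (Cell 14) (Cell 13)))
          m'' 6 (return_pmf (if i = m' 16 then next_level q else q)) ?R"
          unfolding m'(3) by (intro last) (use m' in \<open>auto simp: ready_def\<close>)
      qed
    qed
    let ?c2 = "Add 15 (Cell 15) (Cell 10) ;;
        Add 22 (Cell 11) (Cell 8) ;; Sub 22 (Cell 22) (Cell 15) ;; Sub 22 (Cell 7) (Cell 22) ;;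
        mov 16 (Cell 22) ;; ?c1"
    have calc: "sim ?c2 m' (Suc (Suc (Suc (Suc (Suc ((6 * \<kappa> + 8) * ?X + 2 + 6)))))) (step \<rho> q ?g) ?R"
      if ok': "ok m'" and m': "ready m' \<rho> A q" "m' 15 = b * (q + 1)" "m' 14 = q + 1" for m'
    proof -
      have mf': "m' 7 = D" "m' 8 = 2 * D" "m' 10 = \<rho>" "m' 11 = b * ?g"
        using m' by (auto simp: ready_def)
      let ?G = "b * ?g + 2 * D"
      let ?m1 = "m'(15 := ?P)" let ?m2 = "?m1(22 := ?G)" let ?m3 = "?m2(22 := ?G - ?P)"
      let ?m4 = "?m3(22 := ?X)" let ?m5 = "?m4(16 := ?X)"
      have PM: "?P \<le> M" using bq mf(9) size_bounds(10) by linarith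
      have GM: "?G \<le> M" using bg size_bounds(11) by linarith
      have XM: "?X \<le> M" using size_bounds(8) by (auto simp: expo_def)
      have ok1: "ok ?m1" using ok' PM by (intro memory_ok_upd) auto
      have ok2: "ok ?m2" using GM by (intro memory_ok_upd[OF ok1]) auto
      have ok3: "ok ?m3" using GM by (intro memory_ok_upd[OF ok2]) auto
      have ok4: "ok ?m4" using XM by (intro memory_ok_upd[OF ok3]) auto
      have ok5: "ok ?m5" using XM by (intro memory_ok_upd[OF ok4]) auto
      show ?thesis
        apply (rule sim_Seq_tick[OF _ ok' ok1], simp add: m' mf')
        apply (rule sim_Seq_tick[OF _ ok1 ok2], simp add: mf')
        apply (rule sim_Seq_tick[OF _ ok2 ok3], simp)
        apply (rule sim_Seq_tick[OF _ ok3 ok4], simp add: mf' expo_def)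
        apply (rule sim_Seq_tick[OF _ ok4 ok5], simp)
        apply (rule samp[OF ok5])
           apply (use m' in \<open>auto simp: ready_def\<close>)
        done
    qed
    have mul: "sim (mul 15 (Cell 9) (Cell 14)) ?m2 (3 * (q + 1) + 3) (return_pmf ())
       (\<lambda>m' _. m' 15 = b * (q + 1) \<and> (\<forall>j. j \<noteq> 15 \<longrightarrow> j \<noteq> 21 \<longrightarrow> m' j = ?m2 j))"
      by (rule sim_mono[OF sim_mul[OF ok2]]) (use bq q mf size_bounds(1,10) in auto)
    define \<tau> where "\<tau> = Suc (3 * (q + 1) + 3 + (Suc (Suc (Suc (Suc (Suc ((6 * \<kappa> + 8) * ?X + 2 + 6)))))))"
    have "sim (mul 15 (Cell 9) (Cell 14) ;; ?c2) ?m2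
        (3 * (q + 1) + 3 + (Suc (Suc (Suc (Suc (Suc ((6 * \<kappa> + 8) * ?X + 2 + 6))))))) (step \<rho> q ?g) ?R"
      by (rule sim_Seq_det[OF mul]) (rule calc, use m in \<open>auto simp: ready_def\<close>)
    then have "sim (Add 14 (Cell 12) (Imm 1) ;; mul 15 (Cell 9) (Cell 14) ;; ?c2) ?m1 \<tau> (step \<rho> q ?g) ?R"
      unfolding \<tau>_def by (intro sim_Seq_tick[OF _ ok1 ok2]) (auto simp: mf)
    then have "sim raise_level m (Suc (Suc (\<tau> + 0))) (step \<rho> q ?g) ?R"
      unfolding raise_level_def using q
      by (intro sim_Seq_tick[OF _ ok ok1] sim_If[OF ok1]) (auto simp: mf)
    then show ?thesis
    proof (rule sim_mono)
      have "(6 * \<kappa> + 8) * ?X \<le> (6 * M + 8 * M) * M"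
        using size_bounds by (intro mult_le_mono add_mono) (auto simp: expo_def)
      then have "(6 * \<kappa> + 8) * ?X \<le> 14 * (M * M)" by (simp add: distrib_right)
      moreover have "Suc (Suc (\<tau> + 0)) = z + (3 * q + 22)" if "z = (6 * \<kappa> + 8) * ?X" for z
        unfolding \<tau>_def that[symmetric] by simp
      note this[OF refl]
      ultimately show "Suc (Suc (\<tau> + 0)) \<le> 50 * (M * M)"
        using MM size_bounds(1,3) q by linarith
    qed
  qed
qed

lemma sim_update:
  assumes ok: "ok m" and m: "ready m \<rho> A q" and u: "edge_updates n [u]"
  shows "sim update_program (feed u m) (100 * (M * M)) (step \<rho> q (card (absorb A u) div 2))
    (\<lambda>m' q'. ready m' \<rho> (absorb A u) q' \<and> m' 5 = 2 * q')"
proof -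
  let ?A = "absorb A u"
  have feed: "ok (feed u m)" "ready (feed u m) \<rho> A q"
    "feed u m 3 = (case u of None \<Rightarrow> 0 | Some e \<Rightarrow> Min e)" "feed u m 4 = (case u of None \<Rightarrow> 0 | Some e \<Rightarrow> Max e)"
  proof -
    have "ok (feed u m) \<and> ready (feed u m) \<rho> A q \<and>
      feed u m 3 = (case u of None \<Rightarrow> 0 | Some e \<Rightarrow> Min e) \<and> feed u m 4 = (case u of None \<Rightarrow> 0 | Some e \<Rightarrow> Max e)"
    proof (cases u)
      case None
      then show ?thesis using ok m by (auto simp: ready_def)
    next
      case (Some e)
      then obtain x y where e: "x < y" "y < n" "e = {x, y}" using u by (auto elim: is_edgeE)
      then have "Min e \<le> M" "Max e \<le> M" using size_bounds(1) by auto
      then show ?thesis using ok m Some by (auto simp: ready_def)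
    qed
    then show "ok (feed u m)" "ready (feed u m) \<rho> A q"
    "feed u m 3 = (case u of None \<Rightarrow> 0 | Some e \<Rightarrow> Min e)" "feed u m 4 = (case u of None \<Rightarrow> 0 | Some e \<Rightarrow> Max e)"
      by auto
  qed
  let ?R = "\<lambda>m' q'. ready m' \<rho> ?A q' \<and> m' 5 = 2 * q'"
  have "sim update_program (feed u m) (20 + (50 * (M * M) + Suc 0))
     (bind_pmf (step \<rho> q (card ?A div 2)) return_pmf) ?R"
    unfolding update_program_def
  proof (rule sim_Seq_det[OF sim_match_edge[OF feed(1,2) u feed(3,4)]])
    fix m1 assume "ok m1" "ready m1 \<rho> ?A q"
    then show "sim (raise_level ;; Add 5 (Cell 12) (Cell 12)) m1 (50 * (M * M) + Suc 0)
      (bind_pmf (step \<rho> q (card ?A div 2)) return_pmf) ?R"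
    proof (rule sim_Seq[OF sim_raise_level])
      fix m2 q' assume ok2: "ok m2" and m2: "ready m2 \<rho> ?A q'"
      then have "2 * q' \<le> M" using size_bounds(13) by (auto simp: ready_def)
      then have ok3: "ok (m2(5 := 2 * q'))" using ok2 by auto
      show "sim (Add 5 (Cell 12) (Cell 12)) m2 (Suc 0) (return_pmf q') ?R"
        by (rule sim_tick[OF _ ok2 ok3]) (use m2 in \<open>auto simp: ready_def mult_2\<close>)
    qed
  qed
  then show ?thesis
    unfolding bind_return_pmf'
  proof (rule sim_mono)
    have "30 * M \<le> M * M" using size_bounds(3) by (intro mult_le_mono) auto
    then show "20 + (50 * (M * M) + Suc 0) \<le> 100 * (M * M)" using size_bounds(3) by linarith
  qed auto
qed

section \<open>The whole run: output distribution and resources\<close>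

abbreviation outputs :: "update list \<Rightarrow> nat list pmf" where
  "outputs S \<equiv> bind_pmf (geo r B) (\<lambda>\<rho>. levels \<rho> start_level (greedy_sizes {} S))"

abbreviation \<sigma> :: nat where "\<sigma> \<equiv> memory_bits n T a M"

abbreviation release_alg :: alg where "release_alg \<equiv> Alg (preprocess \<mu> w b\<^sub>0) update_program"

lemma process_sim:
  assumes "ok m" and "ready m \<rho> A q" and "edge_updates n us"
  shows "rel_spmf (\<lambda>rs ys. map fst rs = ys \<and> (\<forall>(y, t, s) \<in> set rs. t \<le> 100 * (M * M) \<and> s \<le> \<sigma>))
    (process update_program us m) (spmf_of_pmf (levels \<rho> q (greedy_sizes A us)))"
  using assms
proof (induction us arbitrary: m A q)
  case Nil
  show ?case by simp
next
  case (Cons u us)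
  have u: "edge_updates n [u]" "edge_updates n us"
    using Cons.prems(3) by (cases u; simp)+
  have eq: "spmf_of_pmf (levels \<rho> q (greedy_sizes A (u # us))) =
    bind_spmf (spmf_of_pmf (step \<rho> q (card (absorb A u) div 2)))
      (\<lambda>q'. map_spmf ((#) (2 * q')) (spmf_of_pmf (levels \<rho> q' (greedy_sizes (absorb A u) us))))"
    by (simp add: spmf_of_pmf_bind)
  show ?case
    unfolding eq process.simps
  proof (rule rel_spmf_bindI[OF sim_update[OF Cons.prems(1,2) u(1), unfolded sim_def]])
    fix x q'
    assume x: "(case x of (m', t, s) \<Rightarrow> \<lambda>y. ok m' \<and> (ready m' \<rho> (absorb A u) y \<and> m' 5 = 2 * y) \<and>
      t \<le> 100 * (M * M) \<and> s \<le> \<sigma>) q'"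
    obtain m' t s where xs: "x = (m', t, s)" by (cases x)
    have "rel_spmf (\<lambda>rs ys. map fst rs = ys \<and> (\<forall>(y, t, s) \<in> set rs. t \<le> 100 * (M * M) \<and> s \<le> \<sigma>))
      (process update_program us m') (spmf_of_pmf (levels \<rho> q' (greedy_sizes (absorb A u) us)))"
      using x xs u(2) by (intro Cons.IH) auto
    then show "rel_spmf (\<lambda>rs ys. map fst rs = ys \<and> (\<forall>(y, t, s) \<in> set rs. t \<le> 100 * (M * M) \<and> s \<le> \<sigma>))
      (case x of (m', t, s) \<Rightarrow> map_spmf (\<lambda>rs. (m' 5, t, s) # rs) (process update_program us m'))
      (map_spmf ((#) (2 * q')) (spmf_of_pmf (levels \<rho> q' (greedy_sizes (absorb A u) us))))"
      using x unfolding xs prod.case spmf_rel_map by (auto elim!: rel_spmf_mono)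
  qed
qed

text \<open>This single coupling yields the output distribution by projection to the released
  values, termination by equality of total mass, and the resource bounds for all coin
  outcomes.\<close>

lemma run_sim:
  assumes "edge_updates n S"
  shows "rel_spmf (\<lambda>(t, s, rs) ys. map fst rs = ys \<and> t \<le> 100 * (M * M) \<and> s \<le> \<sigma> \<and>
      (\<forall>(y, t, s) \<in> set rs. t \<le> 100 * (M * M) \<and> s \<le> \<sigma>))
    (run release_alg n T a S) (spmf_of_pmf (outputs S))"
proof -
  have eq: "spmf_of_pmf (outputs S) = bind_spmf (spmf_of_pmf (geo r B))
      (\<lambda>\<rho>. spmf_of_pmf (levels \<rho> start_level (greedy_sizes {} S)))"
    by (simp add: spmf_of_pmf_bind)
  show ?thesis
    unfolding eq run_def alg.sel
  proof (rule rel_spmf_bindI[OF sim_preprocess[unfolded sim_def]])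
    fix x \<rho>
    assume x: "(case x of (m', t, s) \<Rightarrow> \<lambda>y. ok m' \<and> ready m' y {} start_level \<and>
      t \<le> 100 * (M * M) \<and> s \<le> \<sigma>) \<rho>"
    obtain m' t s where xs: "x = (m', t, s)" by (cases x)
    have "rel_spmf (\<lambda>rs ys. map fst rs = ys \<and> (\<forall>(y, t, s) \<in> set rs. t \<le> 100 * (M * M) \<and> s \<le> \<sigma>))
      (process update_program S m') (spmf_of_pmf (levels \<rho> start_level (greedy_sizes {} S)))"
      using x xs assms by (intro process_sim) auto
    then show "rel_spmf (\<lambda>(t, s, rs) ys. map fst rs = ys \<and> t \<le> 100 * (M * M) \<and> s \<le> \<sigma> \<and>
        (\<forall>(y, t, s) \<in> set rs. t \<le> 100 * (M * M) \<and> s \<le> \<sigma>))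
      (case x of (m, t, s) \<Rightarrow> map_spmf (\<lambda>rs. (t, s, rs)) (process update_program S m))
      (spmf_of_pmf (levels \<rho> start_level (greedy_sizes {} S)))"
      using x unfolding xs prod.case spmf_rel_map by (auto elim!: rel_spmf_mono)
  qed
qed

lemma released_eq:
  assumes "edge_updates n S"
  shows "released release_alg n T a S = spmf_of_pmf (outputs S)"
proof -
  have "rel_spmf (\<lambda>x ys. (case x of (t, s, rs) \<Rightarrow> map fst rs) = ys)
    (run release_alg n T a S) (spmf_of_pmf (outputs S))"
    by (rule rel_spmf_mono[OF run_sim[OF assms]]) auto
  then show ?thesis
    unfolding released_def spmf_rel_eq[symmetric] spmf_rel_map .
qed

lemma run_bounds:
  assumes "edge_updates n S"
  shows "always_halts release_alg n T a S"
    and "real \<sigma> \<le> X \<Longrightarrow> space_le release_alg n T a S X"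
    and "real (100 * (M * M)) \<le> X \<Longrightarrow> preprocessing_time_le release_alg n T a S X"
    and "real (100 * (M * M)) \<le> X \<Longrightarrow> update_time_le release_alg n T a S X"
proof -
  show "always_halts release_alg n T a S"
    unfolding always_halts_def lossless_spmf_def
    using rel_spmf_weightD[OF run_sim[OF assms]] by simp
  have *: "t\<^sub>0 \<le> 100 * (M * M)" "s\<^sub>0 \<le> \<sigma>" "(y, t, s) \<in> set rs \<Longrightarrow> t \<le> 100 * (M * M)"
    "(y, t, s) \<in> set rs \<Longrightarrow> s \<le> \<sigma>"
    if "(t\<^sub>0, s\<^sub>0, rs) \<in> set_spmf (run release_alg n T a S)" for t\<^sub>0 s\<^sub>0 rs y t s
    using rel_spmf_setD1[OF run_sim[OF assms] that] by auto
  have mono: "real x \<le> X" if "x \<le> z" "real z \<le> X" for x z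
    using that by linarith
  show "real \<sigma> \<le> X \<Longrightarrow> space_le release_alg n T a S X"
    unfolding space_le_def using * mono by blast
  show "real (100 * (M * M)) \<le> X \<Longrightarrow> preprocessing_time_le release_alg n T a S X"
    unfolding preprocessing_time_le_def using * mono by blast
  show "real (100 * (M * M)) \<le> X \<Longrightarrow> update_time_le release_alg n T a S X"
    unfolding update_time_le_def using * mono by blast
qed

section \<open>Privacy with the chosen parameters\<close>

lemma r_conv: "r = 1 - 1 / real k"
  by (simp add: r_def k_def power_one_over)

text \<open>\<open>1 / r = 1 + 1 / (k - 1)\<close>, and \<open>k - 1 \<ge> k / 2\<close> because
  \<open>k \<ge> 2\<close>.\<close>

lemma inverse_r_le: "1 / r \<le> exp (2 / real k)"
proof -
  have k: "2 \<le> real k" using k_ge by simp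
  have "1 / r = 1 + 1 / (real k - 1)" using k by (simp add: r_conv field_simps)
  also have "\<dots> \<le> 1 + 2 / real k" using k by (simp add: field_simps)
  also have "\<dots> \<le> exp (2 / real k)" by (rule exp_ge_add_one_self)
  finally show ?thesis .
qed

text \<open>For \<open>w \<ge> n\<close> the level is frozen from the beginning and both output
  distributions coincide. Otherwise the exponent is \<open>b * (1 + 4 * len)\<close> and each factor
  \<open>1 / r\<close> costs \<open>2 / k\<close>. By \<open>k \<ge> w * len\<close>, the total of
  at most \<open>10 * b * len / k\<close> is at most \<open>10 * b / w\<close>, hence at most
  \<open>\<epsilon>\<close>.\<close>

lemma outputs_private:
  assumes "0 < \<epsilon>" and w: "10 * real b\<^sub>0 \<le> \<epsilon> * real w"
    and "edge_updates n S" and "edge_updates n S'" and "node_neighboring n S S'"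
  shows "measure (measure_pmf (outputs S)) Y \<le> exp \<epsilon> * measure (measure_pmf (outputs S')) Y"
proof (cases "w < n")
  case False
  have len: "length S = length S'" using assms(5) by (simp add: node_neighboring_def)
  have "levels \<rho> start_level (greedy_sizes {} S) = levels \<rho> start_level (greedy_sizes {} S')" for \<rho>
    using False by (simp add: levels_final start_level_def len)
  then have "outputs S = outputs S'" by simp
  then show ?thesis
    using mult_right_mono[of 1 "exp \<epsilon>" "measure (measure_pmf (outputs S')) Y"] assms(1) by simp
next
  case True
  \<comment> \<open>\<open>2 * len\<close> raises suffice, since
    \<open>2 * 2 ^ len - 2 \<ge> 2 ^ len\<close> for \<open>len \<ge> 1\<close>.\<close>
  have n: "n \<le> (next_level ^^ (2 * len)) 0"
  proof -
    have "2 ^ len \<le> (next_level ^^ (2 * len)) 0"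
      using next_level_funpow_ge[of len] len_pos one_le_power[of "2::nat" len]
        self_le_power[of "2::nat" len] by linarith
    then show ?thesis using n_less by linarith
  qed
  have bn: "2 * D + b * n \<le> B"
    using mult_le_mono1[OF b_le, of n] by (simp add: B_def)
  have le_n: "\<forall>g\<in>set (greedy_sizes {} S'). g \<le> n"
    using greedy_sizes_le[OF _ assms(4)] by auto
  have "measure (measure_pmf (outputs S)) Y
      \<le> (1 / r) ^ (b + 2 * b * (2 * len)) * measure (measure_pmf (outputs S')) Y"
    using noisy_levels_private[OF greedy_sizes_sensitivity[OF assms(5,3,4)] n le_n bn] True
    by (simp add: start_level_def)
  also have "\<dots> \<le> exp \<epsilon> * measure (measure_pmf (outputs S')) Y"
  proof (rule mult_right_mono)
    have k: "real w * real len \<le> real k"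
      using kappa(2) True by (simp flip: of_nat_mult)
    have "real b * 10 * real len \<le> real b\<^sub>0 * 10 * real len"
      by (intro mult_right_mono) (auto simp: b_def)
    also have "\<dots> \<le> \<epsilon> * real w * real len" using w by (intro mult_right_mono) (auto simp: mult.commute)
    also have "\<dots> \<le> \<epsilon> * real k" using k assms(1) by (simp add: mult.assoc)
    finally have 1: "real b * (10 * real len) \<le> \<epsilon> * real k" by simp
    have "real b * (2 + 8 * real len) \<le> real b * (10 * real len)"
      using len_pos by (intro mult_left_mono) auto
    then have e: "real b * (2 + 8 * real len) / real k \<le> \<epsilon>" using 1 k_ge by (simp add: field_simps)
    have "(1 / r) ^ (b + 2 * b * (2 * len)) \<le> exp (2 / real k) ^ (b + 2 * b * (2 * len))"
      using inverse_r_le r_bounds by (intro power_mono) auto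
    also have "\<dots> = exp (real b * (2 + 8 * real len) / real k)"
      by (simp add: exp_of_nat_mult[symmetric] field_simps)
    also have "\<dots> \<le> exp \<epsilon>" using e by simp
    finally show "(1 / r) ^ (b + 2 * b * (2 * len)) \<le> exp \<epsilon>" .
  qed simp
  finally show ?thesis .
qed

section \<open>Accuracy with the chosen parameters\<close>

text \<open>From \<open>r \<le> exp (- (1 / k))\<close> follows
  \<open>r ^ D \<le> exp (- (\<mu> * len))\<close>, which is at most \<open>n powr (- \<mu>)\<close>
  by \<open>n < 2 ^ len\<close> and \<open>2 \<le> exp 1\<close>. The union bound costs
  \<open>T + 1 \<le> 2 * T \<le> n powr (c + 1)\<close>, and \<open>c + 2 \<le> \<mu>\<close> leaves
  one power of \<open>n\<close>.\<close>

lemma failure_le: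
  assumes "2 \<le> n" and "1 \<le> T" and "real T \<le> real n powr c" and "c + 2 \<le> real \<mu>"
  shows "real (T + 1) * r ^ D \<le> real n powr (- 1)"
proof -
  have n: "2 \<le> real n" using assms(1) by simp
  have "r \<le> exp (- (1 / real k))"
    using exp_ge_add_one_self[of "- (1 / real k)"] by (simp add: r_conv)
  then have "r ^ D \<le> exp (- (1 / real k)) ^ D" using r_bounds by (intro power_mono) auto
  also have "\<dots> = exp (- real (\<mu> * len))"
    using k_ge by (simp add: exp_of_nat_mult[symmetric] D_def)
  also have "\<dots> = inverse (exp 1 ^ (\<mu> * len))" by (simp add: exp_minus exp_of_nat_mult[symmetric])
  also have "\<dots> \<le> inverse (real n ^ \<mu>)"
  proof (rule le_imp_inverse_le)
    have "n ^ \<mu> \<le> (2 ^ len) ^ \<mu>" using n_less by (intro power_mono) auto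
    then have "real n ^ \<mu> \<le> 2 ^ (\<mu> * len)"
      by (metis mult.commute numeral_power_le_of_nat_cancel_iff of_nat_le_iff of_nat_numeral of_nat_power power_mult)
    also have "\<dots> \<le> exp 1 ^ (\<mu> * len)"
      using exp_ge_add_one_self[of 1] by (intro power_mono) auto
    finally show "real n ^ \<mu> \<le> exp 1 ^ (\<mu> * len)" .
  qed (use n in simp)
  also have "\<dots> = real n powr (- real \<mu>)" using n by (simp add: powr_minus powr_realpow)
  finally have r: "r ^ D \<le> real n powr (- real \<mu>)" .
  have "real (T + 1) \<le> 2 * real T" using assms(2) by simp
  also have "\<dots> \<le> real n * real n powr c" using assms(3) n by (intro mult_mono) auto
  also have "\<dots> = real n powr (c + 1)" using n by (simp add: powr_add)
  finally have "real (T + 1) * r ^ D \<le> real n powr (c + 1) * real n powr (- real \<mu>)"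
    using r r_bounds by (intro mult_mono) auto
  also have "\<dots> = real n powr (c + 1 - real \<mu>)" by (simp add: powr_add[symmetric])
  also have "\<dots> \<le> real n powr (- 1)" using assms(4) n by (intro powr_mono) auto
  finally show ?thesis .
qed

lemma len_le_log:
  assumes "2 \<le> n"
  shows "real len \<le> 2 * log 2 (real n)"
proof -
  have "1 \<le> log 2 (real n)" using assms by (simp add: le_log_iff)
  moreover have "real len \<le> log 2 (real n) + 1"
  proof -
    have "2 ^ (len - 1) \<le> n" using floorlog_bounds[of n 2] n_pos by (simp add: len_def)
    then have "real (len - 1) \<le> log 2 (real n)"
      using n_pos by (subst le_log_iff) (auto simp: powr_realpow numeral_power_le_of_nat_cancel_iff)
    then show ?thesis using len_pos by linarith
  qed
  ultimately show ?thesis by linarith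
qed

lemma outputs_accurate:
  assumes "0 < \<epsilon>" and w_b: "\<epsilon> * real w \<le> 20 * real b\<^sub>0" and w_1: "1 < w \<Longrightarrow> b\<^sub>0 = 1"
    and "2 \<le> n" and "1 \<le> T" and "real T \<le> real n powr c" and "c + 2 \<le> real \<mu>" 
    and S: "edge_updates n S" "length S = T"
  shows "1 - real n powr (- 1) \<le> measure (measure_pmf (outputs S))
    {ys. list_all2 (\<lambda>g y. 2 * g \<le> y \<and> real y \<le> 3 * real g + 1000 * real \<mu> * (1 / \<epsilon>) * (log 2 (real n))\<^sup>2)
      (greedy_sizes {} S) ys}" (is "_ \<le> measure _ {ys. list_all2 (?P ?\<zeta>) _ ys}")
proof (cases "w < n")
  case False
  have log: "1 \<le> log 2 (real n)" using assms(4) by (simp add: le_log_iff)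
  \<comment> \<open>\<open>w \<ge> n \<ge> 2\<close> forces \<open>b\<^sub>0 = 1\<close>, so
    \<open>\<epsilon> * n \<le> 20\<close> and the constant output \<open>2 * n\<close> lies within
    the additive error.\<close>
  have "b\<^sub>0 = 1" using w_1 False assms(4) by simp
  then have "\<epsilon> * real n \<le> 20" using w_b False assms(1) mult_left_mono[of "real n" "real w" \<epsilon>] by linarith
  then have "2 * real n \<le> 40 * (1 / \<epsilon>)" using assms(1) by (simp add: field_simps)
  also have "\<dots> \<le> 1000 * real \<mu> * (1 / \<epsilon>)" using assms(1) mu_pos by (intro mult_right_mono) auto
  also have "\<dots> \<le> ?\<zeta>" 
    using log assms(1) mult_left_mono[of 1 "(log 2 (real n))\<^sup>2" "1000 * real \<mu> * (1 / \<epsilon>)"] by simp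
  finally have z: "2 * real n \<le> ?\<zeta>" .
  have "list_all2 (?P ?\<zeta>) (greedy_sizes {} S) (replicate (length S) (2 * n))"
    using greedy_sizes_le[OF _ S(1), of "{}"] z
    by (fastforce simp: list_all2_conv_all_nth)
  then have "measure (measure_pmf (outputs S)) {ys. list_all2 (?P ?\<zeta>) (greedy_sizes {} S) ys} = 1"
    using False by (simp add: levels_final start_level_def)
  then show ?thesis by simp
next
  case True
  \<comment> \<open>If \<open>b = 2 * D\<close>, the slack \<open>2 * D\<close> is a single unit of
    the scaled count, and strictness of the inequality leaves no error at all.\<close>
  define e where "e = (if 2 * D \<le> b\<^sub>0 then 0 else 2 * real D / real b\<^sub>0)"
  have e: "real x \<le> real y + e" if "b * x < b * y + 2 * D" for x y
  proof (cases "2 * D \<le> b\<^sub>0")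
    case True
    then have "2 * D * x < 2 * D * (y + 1)" using that by (simp add: b_def)
    then have "x < y + 1" by (metis mult_less_cancel1)
    then show ?thesis using True by (simp add: e_def)
  next
    case False
    then have "b\<^sub>0 * x < b\<^sub>0 * y + 2 * D" using that by (simp add: b_def)
    then have "real (b\<^sub>0 * x) \<le> real (b\<^sub>0 * y + 2 * D)" by linarith
    then show ?thesis using False b0_pos by (simp add: e_def field_simps)
  qed
  have z: "3 * e \<le> ?\<zeta>"
  proof -
    \<comment> \<open>\<open>k \<le> 2 * w * len\<close>, \<open>len \<le> 2 * log 2 n\<close> and
      \<open>\<epsilon> * w \<le> 20 * b\<^sub>0\<close> give the factor 160 for
      \<open>\<epsilon> * D / b\<^sub>0\<close>, and thus \<open>3 * 2 * 160 = 960\<close> for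
      \<open>3 * e\<close>.\<close>
    have "k \<le> 2 * (w * len)" using kappa(3) True by simp
    then have "real k \<le> real (2 * (w * len))" by (simp only: of_nat_le_iff)
    then have "real k * (\<epsilon> * (\<mu> * len)) \<le> real (2 * (w * len)) * (\<epsilon> * (\<mu> * len))"
      using assms(1) by (intro mult_right_mono) auto
    then have "\<epsilon> * real D \<le> (\<epsilon> * real w) * (2 * real \<mu> * (real len)\<^sup>2)"
      by (simp add: D_def power2_eq_square mult_ac)
    also have "\<dots> \<le> (20 * real b\<^sub>0) * (2 * real \<mu> * (2 * log 2 (real n))\<^sup>2)"
      using len_le_log[OF assms(4)] by (intro mult_mono[OF w_b] mult_left_mono power_mono) auto
    finally have "\<epsilon> * real D \<le> real b\<^sub>0 * (160 * real \<mu> * (log 2 (real n))\<^sup>2)"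
      by (simp add: power2_eq_square)
    then have "3 * (2 * real D / real b\<^sub>0) \<le> 960 * real \<mu> * (1 / \<epsilon>) * (log 2 (real n))\<^sup>2"
      using assms(1) b0_pos by (simp add: field_simps)
    also have "\<dots> \<le> ?\<zeta>" using assms(1) by (intro mult_right_mono) auto
    finally show ?thesis using assms(1) by (simp add: e_def)
  qed
  have "D \<le> B" by (simp add: B_def)
  have "1 - real (length (greedy_sizes {} S) + 1) * r ^ D \<le> measure (measure_pmf (outputs S))
     {ys. list_all2 (\<lambda>g y. 2 * g \<le> y \<and> real y \<le> 3 * (real g + e)) (greedy_sizes {} S) ys}"
    using noisy_levels_accurate[OF e slow_growth_greedy_sizes[OF _ S(1), of "{}", simplified] _ \<open>D \<le> B\<close>] True
    by (simp add: start_level_def e_def)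
  also have "\<dots> \<le> measure (measure_pmf (outputs S)) {ys. list_all2 (?P ?\<zeta>) (greedy_sizes {} S) ys}"
    using z by (intro measure_pmf.finite_measure_mono) (auto elim!: list_all2_mono simp: algebra_simps)
  finally show ?thesis
    using failure_le[OF assms(4-7)] S(2) by simp
qed

section \<open>Space with the chosen parameters\<close>

text \<open>The flags contribute order \<open>n\<close>; the crude \<open>log 2 x \<le> x\<close>
  puts the logarithms of \<open>T\<close> and \<open>M\<close> into that order too, with
  \<open>c\<close> and \<open>\<mu>\<close> in the constant. Only \<open>log 2 a\<close> remains,
  and \<open>\<eta> \<le> 1\<close> bounds it by \<open>log1 (a / \<eta>)\<close>.\<close>

lemma memory_bits_le:
  assumes "1 \<le> T" and "1 \<le> a" and "real T \<le> real n powr c" and "0 \<le> c" and "0 < \<eta>" and "\<eta> \<le> 1"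
  shows "real \<sigma> \<le> (1000 * real \<mu> + c + 200) * (real n * log1 (real a / \<eta>))"
proof -
  have fl: "real (floorlog 2 x) \<le> 1 + log 2 (real x)" if "1 \<le> x" for x
  proof -
    have "floorlog 2 x = nat \<lfloor>log 2 (real x)\<rfloor> + 1" using that by (simp add: floorlog_def)
    moreover have "0 \<le> log 2 (real x)" using that by simp
    ultimately show ?thesis by linarith
  qed
  have log_le: "log 2 x \<le> x" if "1 \<le> x" for x :: real
  proof -
    \<comment> \<open>The tangent bound for \<open>ln\<close> is applied at \<open>x / 2\<close>;
      \<open>1/2 \<le> ln 2 < 1\<close> then passes to base 2.\<close>
    have "ln x - ln 2 \<le> x / 2 - 1"
      using ln_le_minus_one[of "x / 2"] that by (simp add: ln_div)
    then have "ln x \<le> x * (1 / 2)" using ln_2_less_1 by simp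
    also have "\<dots> \<le> x * ln 2" using ln2_ge_two_thirds that by (intro mult_left_mono) auto
    finally show ?thesis by (simp add: log_def field_simps)
  qed
  have n: "1 \<le> real n" and mu: "1 \<le> real \<mu>" using n_pos mu_pos by auto
  define L where "L = log1 (real a / \<eta>)"
  have L1: "1 \<le> L" by (simp add: L_def log1_def)
  have "real a \<le> real a / \<eta>" 
    using assms(5,6) mult_right_mono[of \<eta> 1 "real a"] by (simp add: field_simps)
  then have "log 2 (real a) \<le> L" using assms(2) by (auto simp: L_def log1_def le_max_iff_disj)
  then have fa: "real (floorlog 2 a) \<le> 1 + L" using fl[OF assms(2)] by linarith
  have "log 2 (real T) \<le> log 2 (real n powr c)" using assms(1,3) n by (subst log_le_cancel_iff) auto
  also have "\<dots> = c * log 2 (real n)" using n by (simp add: log_powr)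
  also have "\<dots> \<le> c * real n" using log_le[OF n] assms(4) by (intro mult_left_mono)
  finally have fT: "real (floorlog 2 T) \<le> 1 + c * real n" using fl[OF assms(1)] by linarith
  have "log 2 (real M) = log 2 (30 * real \<mu>) + 4 * log 2 (real n)"
    using n mu by (simp add: M_def log_mult log_nat_power)
  also have "\<dots> \<le> 30 * real \<mu> + 4 * real n"
    using log_le[OF n] log_le[of "30 * real \<mu>"] mu by simp
  finally have fM: "real (floorlog 2 M) \<le> 1 + 30 * real \<mu> + 4 * real n"
    using fl[of M] size_bounds(3) by linarith
  have "real \<sigma> \<le> 50 + 720 * real \<mu> + 98 * real n + c * real n + L"
    using fa fT fM by (simp add: memory_bits_def)
  also have "\<dots> \<le> (1000 * real \<mu> + c + 200) * (real n * L)"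
  proof -
    define N where "N = real n * L"
    have nL: "real n \<le> N" "L \<le> N"
      using n L1 by (auto simp: N_def mult_le_cancel_left1 mult_le_cancel_right1)
    define P Q where "P = real \<mu> * N" and "Q = c * N"
    have "1 \<le> N" using nL n by linarith
    then have "real \<mu> * 1 \<le> P" unfolding P_def by (rule mult_left_mono) simp
    moreover have "c * real n \<le> Q" unfolding Q_def using nL(1) assms(4) by (rule mult_left_mono)
    ultimately have "50 + 720 * real \<mu> + 98 * real n + c * real n + L \<le> 1000 * P + Q + 200 * N"
      using nL n mu by linarith
    then show ?thesis by (simp add: P_def Q_def N_def distrib_right)
  qed
  finally show ?thesis by (simp add: L_def)
qed

end

section \<open>Choice of the constants and conclusion\<close>

theorem theorem4p9:
  fixes c :: real
  assumes "c \<ge> 1"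
  shows "\<exists>(C :: real) (c' :: real) (K :: real) (d :: nat). C > 0 \<and> c' > 0 \<and> K > 0 \<and>
    (\<forall>(\<eta> :: real) (\<epsilon> :: real). 0 < \<eta> \<and> \<eta> \<le> 1 \<and> 0 < \<epsilon> \<longrightarrow>
      (\<exists>A :: alg. \<forall>(n :: nat) (T :: nat) (a :: nat).
         1 \<le> n \<and> n \<le> T \<and> real T \<le> real n powr c \<and> 1 \<le> a \<longrightarrow>
           node_dp n T \<epsilon> (released A n T a) \<and>
           (\<forall>S. is_stream n T S \<longrightarrow>
              (a \<ge> (MAX t\<in>{1..T}. arboricity (graph_at S t)) \<longrightarrow>
                 measure (measure_spmf (released A n T a S))
                   {ys. \<forall>t\<in>{1..T}.
                      is_approx ((1 + \<eta>) * (2 + real a))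
                        (C * (1 / \<epsilon>) * (1 / \<eta>)\<^sup>2 * real a * (log 2 (real n))\<^sup>2)
                        (real (max_matching_size (graph_at S t))) (real (ys ! (t - 1)))}
                 \<ge> 1 - real n powr (- c')) \<and>
              space_le A n T a S
                (C * (real n * log1 (real a / \<eta>)
                      + (1 / \<epsilon>) * (1 / \<eta>) ^ 3 * real a * (log 2 (real n))\<^sup>2 * log1 (real a))) \<and>
              always_halts A n T a S \<and>
              preprocessing_time_le A n T a S (K * real n ^ d) \<and>
              update_time_le A n T a S (K * real n ^ d))))"
proof -
  define \<mu> where "\<mu> = nat \<lceil>c\<rceil> + 2"
  define C where "C = 1000 * real \<mu> + c + 200"
  \<comment> \<open>The time bound is \<open>100 * M ^ 2\<close> with
    \<open>M = 30 * \<mu> * n ^ 4\<close>, whence \<open>100 * 30 ^ 2\<close> here and the degree 8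
    below.\<close>
  define K where "K = 90000 * (real \<mu>)\<^sup>2"
  have mu: "1 \<le> \<mu>" "c + 2 \<le> real \<mu>" using assms by (auto simp: \<mu>_def)
  have CK: "0 < C" "0 < K" "1000 * real \<mu> \<le> C" using assms mu by (auto simp: C_def K_def)
  show ?thesis
  proof (rule exI[of _ C], rule exI[of _ 1], rule exI[of _ K], rule exI[of _ 8],
      intro conjI allI impI CK zero_less_one)
    fix \<eta> \<epsilon> :: real
    assume "0 < \<eta> \<and> \<eta> \<le> 1 \<and> 0 < \<epsilon>"
    then have eta: "0 < \<eta>" "\<eta> \<le> 1" and eps: "0 < \<epsilon>" by auto
    define w where "w = nat \<lceil>10 / \<epsilon>\<rceil>"
    define b\<^sub>0 where "b\<^sub>0 = max 1 (nat \<lfloor>\<epsilon> / 10\<rfloor>)"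
    have w_ge: "10 / \<epsilon> \<le> real w" and w_le: "real w < 10 / \<epsilon> + 1"
      using eps by (auto simp: w_def) linarith+
    have "0 < real w" using w_ge eps by (smt (verit) divide_pos_pos)
    then have w1: "1 \<le> w" by simp
    have b1: "1 \<le> b\<^sub>0" by (simp add: b\<^sub>0_def)
    have w10: "10 \<le> \<epsilon> * real w" using w_ge eps by (simp add: field_simps)
    have bw: "10 * real b\<^sub>0 \<le> \<epsilon> * real w" "\<epsilon> * real w \<le> 20 * real b\<^sub>0" "1 < w \<Longrightarrow> b\<^sub>0 = 1"
    proof -
      have *: "10 * real b\<^sub>0 \<le> \<epsilon> * real w \<and> \<epsilon> * real w \<le> 20 * real b\<^sub>0 \<and> (1 < w \<longrightarrow> b\<^sub>0 = 1)"
      proof (cases "10 \<le> \<epsilon>")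
        case True
        then have "10 / \<epsilon> \<le> 1" by (simp add: field_simps)
        then have "w = 1" using w1 w_le by linarith
        moreover have "1 \<le> \<lfloor>\<epsilon> / 10\<rfloor>" using True by linarith
        moreover have "real b\<^sub>0 = real_of_int \<lfloor>\<epsilon> / 10\<rfloor>" using calculation(2) unfolding b\<^sub>0_def by linarith
        \<comment> \<open>Rounding down a number that is at least 1 loses less than a factor 2,
          hence 20 in place of 10.\<close>
        moreover have "10 * real_of_int \<lfloor>\<epsilon> / 10\<rfloor> \<le> \<epsilon>" "\<epsilon> \<le> 20 * real_of_int \<lfloor>\<epsilon> / 10\<rfloor>"
          using calculation(2) by linarith+
        ultimately show ?thesis by simp
      next
        case False
        then have b: "b\<^sub>0 = 1" by (simp add: b\<^sub>0_def)
        have "\<epsilon> * real w \<le> \<epsilon> * (10 / \<epsilon> + 1)" using w_le eps by (intro mult_left_mono) auto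
        also have "\<dots> \<le> 20" using eps False by (simp add: distrib_left)
        finally show ?thesis using b w10 by simp
      qed
      then show "10 * real b\<^sub>0 \<le> \<epsilon> * real w" "\<epsilon> * real w \<le> 20 * real b\<^sub>0" "1 < w \<Longrightarrow> b\<^sub>0 = 1" by auto
    qed
    let ?A = "Alg (preprocess \<mu> w b\<^sub>0) update_program"
    show "\<exists>A :: alg. \<forall>(n :: nat) (T :: nat) (a :: nat).
         1 \<le> n \<and> n \<le> T \<and> real T \<le> real n powr c \<and> 1 \<le> a \<longrightarrow>
           node_dp n T \<epsilon> (released A n T a) \<and>
           (\<forall>S. is_stream n T S \<longrightarrow>
              (a \<ge> (MAX t\<in>{1..T}. arboricity (graph_at S t)) \<longrightarrow>
                 measure (measure_spmf (released A n T a S))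
                   {ys. \<forall>t\<in>{1..T}.
                      is_approx ((1 + \<eta>) * (2 + real a))
                        (C * (1 / \<epsilon>) * (1 / \<eta>)\<^sup>2 * real a * (log 2 (real n))\<^sup>2)
                        (real (max_matching_size (graph_at S t))) (real (ys ! (t - 1)))}
                 \<ge> 1 - real n powr (- 1)) \<and>
              space_le A n T a S
                (C * (real n * log1 (real a / \<eta>)
                      + (1 / \<epsilon>) * (1 / \<eta>) ^ 3 * real a * (log 2 (real n))\<^sup>2 * log1 (real a))) \<and>
              always_halts A n T a S \<and>
              preprocessing_time_le A n T a S (K * real n ^ 8) \<and>
              update_time_le A n T a S (K * real n ^ 8))"
    proof (rule exI[of _ ?A], intro allI impI, elim conjE)
      fix n T a :: nat
      assume n: "1 \<le> n" and nT: "n \<le> T" and Tc: "real T \<le> real n powr c" and a: "1 \<le> a"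
      interpret algorithm n T a \<mu> w b\<^sub>0
        using n mu w1 b1 by unfold_locales
      have T: "1 \<le> T" using n nT by simp
      have stream: "edge_updates n S" "length S = T" if "is_stream n T S" for S
        using that by (auto simp: is_stream_def edge_updates_def)
      have dp: "node_dp n T \<epsilon> (released ?A n T a)"
        unfolding node_dp_def
        using outputs_private[OF eps bw(1)] by (auto simp: stream released_eq)
      let ?\<zeta> = "C * (1 / \<epsilon>) * (1 / \<eta>)\<^sup>2 * real a * (log 2 (real n))\<^sup>2"
      have zeta: "1000 * real \<mu> * (1 / \<epsilon>) * (log 2 (real n))\<^sup>2 \<le> ?\<zeta>"
      proof -
        have "1 \<le> (1 / \<eta>)\<^sup>2" using eta by (intro one_le_power) simp
        then have "1 * 1 \<le> (1 / \<eta>)\<^sup>2 * real a" using a by (intro mult_mono) auto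
        then have "(1000 * real \<mu> * (1 / \<epsilon>)) * 1 \<le> (C * (1 / \<epsilon>)) * ((1 / \<eta>)\<^sup>2 * real a)"
          using CK eps by (intro mult_mono) auto
        then show ?thesis by (intro mult_right_mono) (simp_all add: mult.assoc)
      qed
      have acc: "1 - real n powr (- 1) \<le> measure (measure_spmf (released ?A n T a S))
         {ys. \<forall>t\<in>{1..T}. is_approx ((1 + \<eta>) * (2 + real a)) ?\<zeta>
            (real (max_matching_size (graph_at S t))) (real (ys ! (t - 1)))}"
        if S: "is_stream n T S" for S
      proof (cases "n = 1")
        \<comment> \<open>For \<open>n = 1\<close> the required probability is
          \<open>1 - 1 = 0\<close>.\<close>
        case True
        then show ?thesis by simp
      next
        case False
        then have n2: "2 \<le> n" using n by simp
        let ?P = "\<lambda>g y. 2 * g \<le> y \<and> real y \<le> 3 * real g + 1000 * real \<mu> * (1 / \<epsilon>) * (log 2 (real n))\<^sup>2"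
        have "1 - real n powr (- 1) \<le> measure (measure_pmf (outputs S))
            {ys. list_all2 ?P (greedy_sizes {} S) ys}"
          by (rule outputs_accurate[OF eps bw(2,3) n2 T Tc mu(2) stream[OF S]])
        also have "\<dots> \<le> measure (measure_pmf (outputs S))
          {ys. \<forall>t\<in>{1..T}. is_approx ((1 + \<eta>) * (2 + real a)) ?\<zeta>
            (real (max_matching_size (graph_at S t))) (real (ys ! (t - 1)))}"
        proof (rule measure_pmf.finite_measure_mono, safe)
          fix ys t
          assume ys: "list_all2 ?P (greedy_sizes {} S) ys" and t: "t \<in> {1..T}"
          define g where "g = card (greedy {} (take t S)) div 2"
          define R where "R = max_matching_size (graph_at S t)"
          have "t - 1 < length S" using t stream(2)[OF S] by auto
          then have y: "?P g (ys ! (t - 1))"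
            using list_all2_nthD[OF ys, of "t - 1"] t by (simp add: nth_greedy_sizes g_def)
          have "edge_updates n (take t S)"
            using stream(1)[OF S] by (auto simp: edge_updates_def dest: in_set_takeD)
          from greedy_two_approximation[OF this] have gR: "g \<le> R" "R \<le> 2 * g"
            by (auto simp: g_def R_def graph_at_def)
          \<comment> \<open>The output is at most \<open>3 * g\<close> plus the error, and
            \<open>g \<le> R\<close>; the required factor is at least 3 because
            \<open>a \<ge> 1\<close> and \<open>\<eta> > 0\<close>. The lower bound comes from
            \<open>R \<le> 2 * g\<close>.\<close>
          have "1 * 3 \<le> (1 + \<eta>) * (2 + real a)" using eta a by (intro mult_mono) auto
          then have "3 * real R \<le> (1 + \<eta>) * (2 + real a) * real R" by (intro mult_right_mono) auto
          moreover have "0 \<le> ?\<zeta>" using CK eps by simp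
          ultimately show "is_approx ((1 + \<eta>) * (2 + real a)) ?\<zeta> (real (max_matching_size (graph_at S t)))
              (real (ys ! (t - 1)))"
            unfolding is_approx_def R_def[symmetric] using y gR zeta by linarith
        qed simp
        finally show ?thesis by (simp add: released_eq[OF stream(1)[OF S]])
      qed
      have "real \<sigma> \<le> C * (real n * log1 (real a / \<eta>))"
        unfolding C_def by (rule memory_bits_le[OF T a Tc _ eta]) (use assms in simp)
      also have "\<dots> \<le> C * (real n * log1 (real a / \<eta>)
                      + (1 / \<epsilon>) * (1 / \<eta>) ^ 3 * real a * (log 2 (real n))\<^sup>2 * log1 (real a))"
        using CK eps eta by (intro mult_left_mono) (auto simp: log1_def)
      finally have space: "real \<sigma> \<le> \<dots>" .
      have "real (100 * (M * M)) = K * real n ^ 8"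
        by (simp add: M_def K_def power2_eq_square power_add[symmetric] mult_ac)
      then have time: "real (100 * (M * M)) \<le> K * real n ^ 8" by simp
      show "node_dp n T \<epsilon> (released ?A n T a) \<and>
           (\<forall>S. is_stream n T S \<longrightarrow>
              (a \<ge> (MAX t\<in>{1..T}. arboricity (graph_at S t)) \<longrightarrow>
                 measure (measure_spmf (released ?A n T a S))
                   {ys. \<forall>t\<in>{1..T}. is_approx ((1 + \<eta>) * (2 + real a)) ?\<zeta>
                        (real (max_matching_size (graph_at S t))) (real (ys ! (t - 1)))}
                 \<ge> 1 - real n powr (- 1)) \<and>
              space_le ?A n T a S
                (C * (real n * log1 (real a / \<eta>)
                      + (1 / \<epsilon>) * (1 / \<eta>) ^ 3 * real a * (log 2 (real n))\<^sup>2 * log1 (real a))) \<and>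
              always_halts ?A n T a S \<and>
              preprocessing_time_le ?A n T a S (K * real n ^ 8) \<and>
              update_time_le ?A n T a S (K * real n ^ 8))"
        using dp acc run_bounds[OF stream(1)] space time by blast
    qed
  qed
qed

end
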